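(* Let $S=\langle g_1,\dots,g_n\rangle$ be a numerical semigroup and $R=K[[t^S]]$ with maximal ideal $\mathbf m$. If $G(\mathbf m)$ is Buchsbaum, then the length $\lambda$ of $H^0_{\mathcal M}$ as a $G(\mathbf m)$-module is $$\lambda=\sum_{i\in I}(l_i+1),\qquad I=\{i\in\{0,\dots,g_1-1\}\ :\ a_i>b_i\}.$$
   Context: $K$ is an infinite field. A numerical semigroup $S\subseteq\mathbb N$ (with $0\in S$) has minimal generators $g_1<\dots<g_n$ with $\gcd(g_1,\dots,g_n)=1$. $R=K[[t^S]]=K[[t^{g_1},\dots,t^{g_n}]]$, $\mathbf m=(t^{g_1},\dots,t^{g_n})$, $G(\mathbf m)=\bigoplus_{i\ge0}\mathbf m^i/\mathbf m^{i+1}$, $\mathcal M$ is the homogeneous maximal ideal of $G(\mathbf m)$, and $r$ is the reduction number of $\mathbf m$, i.e. the least $r\ge 0$ with $\mathbf m^{r+1}=t^{g_1}\mathbf m^r$. $H^0_{\mathcal M}=\bigcup_{k\ge1}(0:_{G(\mathbf m)}\mathcal M^k)$, which equals $(0:_{G(\mathbf m)}\mathcal M^r)$; $G(\mathbf m)$ is called Buchsbaum if $\mathcal M\cdot H^0_{\mathcal M}=0$. $M=S\setminus\{0\}$; $hM=M+\dots+M$ ($h$ summands), $0M=S$. For $s\in S$ with $s\in hM\setminus(h+1)M$, $\overline{t^s}$ denotes the (nonzero) class of $t^s$ in $\mathbf m^h/\mathbf m^{h+1}\subset G(\mathbf m)$. Apery set: $\mathrm{Ap}_{g_1}(S)=\{\omega_0,\dots,\omega_{g_1-1}\}$,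 where $\omega_i=\min\{s\in S: s\equiv i \bmod g_1\}$. Let $S'=\langle g_1,g_2-g_1,\dots,g_n-g_1\rangle$ and $\omega'_i=\min\{s\in S': s\equiv i\bmod g_1\}$. For $0\le i\le g_1-1$, $a_i$ is the integer with $\omega'_i+a_ig_1=\omega_i$, and $b_i=\max\{l:\omega_i\in lM\}$; one always has $b_i\le a_i$. For $i$ with $a_i>b_i$, $l_i=\max\{l\ge 0: \overline{t^{\omega_i+lg_1}}\in(0:_{G(\mathbf m)}\mathcal M^r)\}$ (this maximum exists). *)

theory Defs
  imports
    "HOL-Computational_Algebra.Formal_Power_Series"
    "HOL-Library.Extended_Nat"
    "HOL-Number_Theory.Cong"
    "HOL-Algebra.Ideal_Product"
    "HOL-Algebra.QuotRing"
    "HOL-Algebra.Module"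
begin

section \<open>Commutative algebra\<close>

abbreviation ideal_pow :: "('a, 'b) ring_scheme \<Rightarrow> 'a set \<Rightarrow> nat \<Rightarrow> 'a set" where
  "ideal_pow R I k \<equiv> I [^]\<^bsub>ideals_set R\<^esub> k"

text \<open>
  The associated graded ring, the direct sum of the groups \<open>I\<^sup>i / I\<^sup>i\<^sup>+\<^sup>1\<close>.  An element is the
  finitely supported family of its homogeneous components, each of them a coset of \<open>I\<^sup>i\<^sup>+\<^sup>1\<close>
  contained in \<open>I\<^sup>i\<close>; the coset \<open>I\<^sup>i\<^sup>+\<^sup>1\<close> is the zero of degree \<open>i\<close>.  For cosets \<open>A\<close> of
  \<open>I\<^sup>i\<^sup>+\<^sup>1\<close> in \<open>I\<^sup>i\<close> and \<open>B\<close> of \<open>I\<^sup>j\<^sup>+\<^sup>1\<close> in \<open>I\<^sup>j\<close>, the set \<^const>\<open>rcoset_mult\<close> \<open>R I\<^sup>i\<^sup>+\<^sup>j\<^sup>+\<^sup>1 A B\<close> is the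
  single coset \<open>I\<^sup>i\<^sup>+\<^sup>j\<^sup>+\<^sup>1 + a b\<close> with \<open>a \<in> A\<close>, \<open>b \<in> B\<close>, although \<open>A\<close> and \<open>B\<close> are not
  themselves cosets of \<open>I\<^sup>i\<^sup>+\<^sup>j\<^sup>+\<^sup>1\<close>.
\<close>

definition assoc_graded :: "('a, 'b) ring_scheme \<Rightarrow> 'a set \<Rightarrow> (nat \<Rightarrow> 'a set) ring" where
  "assoc_graded R I =
    \<lparr>carrier = {x. (\<forall>i. x i \<in> a_rcosets\<^bsub>R\<lparr>carrier := ideal_pow R I i\<rparr>\<^esub> (ideal_pow R I (Suc i)))
                  \<and> finite {i. x i \<noteq> ideal_pow R I (Suc i)}},
     mult = (\<lambda>x y k. finsum (R Quot ideal_pow R I (Suc k))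
               (\<lambda>i. rcoset_mult R (ideal_pow R I (Suc k)) (x i) (y (k - i))) {..k}),
     one = (\<lambda>i. if i = 0 then ideal_pow R I (Suc 0) +>\<^bsub>R\<^esub> \<one>\<^bsub>R\<^esub> else ideal_pow R I (Suc i)),
     zero = (\<lambda>i. ideal_pow R I (Suc i)),
     add = (\<lambda>x y i. x i <+>\<^bsub>R\<^esub> y i)\<rparr>"

text \<open>
  The ideal of elements without component of degree 0.  When \<open>I\<close> is a maximal ideal this is
  the homogeneous maximal ideal of the associated graded ring.
\<close>

definition graded_max :: "('a, 'b) ring_scheme \<Rightarrow> 'a set \<Rightarrow> (nat \<Rightarrow> 'a set) set" where
  "graded_max R I = {x \<in> carrier (assoc_graded R I). x 0 = \<zero>\<^bsub>assoc_graded R I\<^esub> 0}"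

definition annihilator :: "('a, 'b) ring_scheme \<Rightarrow> 'a set \<Rightarrow> 'a set" where
  "annihilator R J = {x \<in> carrier R. \<forall>y\<in>J. x \<otimes>\<^bsub>R\<^esub> y = \<zero>\<^bsub>R\<^esub>}"

definition H0 :: "('a, 'b) ring_scheme \<Rightarrow> 'a set \<Rightarrow> 'a set" where
  "H0 R J = (\<Union>k\<in>{1..}. annihilator R (ideal_pow R J k))"

definition buchsbaum :: "('a, 'b) ring_scheme \<Rightarrow> 'a set \<Rightarrow> bool" where
  "buchsbaum R J \<longleftrightarrow> ideal_prod R J (H0 R J) = {\<zero>\<^bsub>R\<^esub>}"

definition reduction_number :: "('a, 'b) ring_scheme \<Rightarrow> 'a set \<Rightarrow> 'a \<Rightarrow> nat" where
  "reduction_number R I x =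
    (LEAST r. ideal_pow R I (r + 1) = x <#\<^bsub>R\<^esub> ideal_pow R I r)"

definition ideal_module :: "('a, 'b) ring_scheme \<Rightarrow> 'a set \<Rightarrow> ('a, 'a) module" where
  "ideal_module R J =
    \<lparr>carrier = J, mult = mult R, one = \<one>\<^bsub>R\<^esub>, zero = \<zero>\<^bsub>R\<^esub>, add = add R, smult = mult R\<rparr>"

definition module_length :: "('a, 'b) ring_scheme \<Rightarrow> ('a, 'c, 'd) module_scheme \<Rightarrow> enat" where
  "module_length R M =
    Sup {enat k | k. \<exists>N. (\<forall>i\<le>k. submodule (N i) R M) \<and> (\<forall>i<k. N i \<subset> N (Suc i))}"


section \<open>Numerical semigroups\<close>

inductive_set semigroup_gen :: "nat set \<Rightarrow> nat set" for A :: "nat set" where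
  zero: "0 \<in> semigroup_gen A"
| add: "a \<in> A \<Longrightarrow> s \<in> semigroup_gen A \<Longrightarrow> a + s \<in> semigroup_gen A"

text \<open>\<open>mult_M S h\<close> is \<open>hM\<close> for \<open>M = S - {0}\<close>, with the convention \<open>0M = S\<close>.\<close>

definition mult_M :: "nat set \<Rightarrow> nat \<Rightarrow> nat set" where
  "mult_M S h =
    (if h = 0 then S else {sum_list xs | xs. length xs = h \<and> set xs \<subseteq> S - {0}})"

definition order_M :: "nat set \<Rightarrow> nat \<Rightarrow> nat" where
  "order_M S s = (THE h. s \<in> mult_M S h - mult_M S (h + 1))"

text \<open>Index \<open>i\<close> of the Apery set of \<open>S\<close> with respect to \<open>e\<close>.\<close>

definition apery :: "nat set \<Rightarrow> nat \<Rightarrow> nat \<Rightarrow> nat" where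
  "apery S e i = (LEAST s. s \<in> S \<and> [s = i] (mod e))"

definition blowup_semigroup :: "nat \<Rightarrow> (nat \<Rightarrow> nat) \<Rightarrow> nat set" where
  "blowup_semigroup n g = semigroup_gen (insert (g 1) ((\<lambda>j. g j - g 1) ` {2..n}))"

definition a_num :: "nat \<Rightarrow> (nat \<Rightarrow> nat) \<Rightarrow> nat \<Rightarrow> int" where
  "a_num n g i =
    (THE a. int (apery (blowup_semigroup n g) (g 1) i) + a * int (g 1)
            = int (apery (semigroup_gen (g ` {1..n})) (g 1) i))"

definition b_num :: "nat \<Rightarrow> (nat \<Rightarrow> nat) \<Rightarrow> nat \<Rightarrow> nat" where
  "b_num n g i =
    (let S = semigroup_gen (g ` {1..n}) in Max {l. apery S (g 1) i \<in> mult_M S l})"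


section \<open>Semigroup rings\<close>

text \<open>The ring \<open>K[[t\<^sup>S]]\<close>, as a subring of the power series ring; \<open>t\<close> is \<^const>\<open>fps_X\<close>.\<close>

definition semigroup_ring :: "nat set \<Rightarrow> ('k::field fps) ring" where
  "semigroup_ring S =
    \<lparr>carrier = {f. \<forall>s. fps_nth f s \<noteq> 0 \<longrightarrow> s \<in> S}, mult = (*), one = 1, zero = 0, add = (+)\<rparr>"

definition max_ideal :: "nat \<Rightarrow> (nat \<Rightarrow> nat) \<Rightarrow> 'k::field fps set" where
  "max_ideal n g =
    genideal (semigroup_ring (semigroup_gen (g ` {1..n}))) ((\<lambda>j. fps_X ^ g j) ` {1..n})"

text \<open>
  The class of \<open>t\<^sup>s\<close> in \<open>m\<^sup>h / m\<^sup>h\<^sup>+\<^sup>1\<close>, where \<open>h\<close> is the order of \<open>s\<close>, as a homogeneous element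
  of the associated graded ring of \<open>m\<close>.
\<close>

definition monomial_class :: "nat set \<Rightarrow> 'k::field fps set \<Rightarrow> nat \<Rightarrow> (nat \<Rightarrow> 'k fps set)" where
  "monomial_class S m s =
    (\<lambda>i. if i = order_M S s
         then ideal_pow (semigroup_ring S) m (Suc i) +>\<^bsub>semigroup_ring S\<^esub> fps_X ^ s
         else ideal_pow (semigroup_ring S) m (Suc i))"

text \<open>
  The type argument selects the coefficient field, which does not occur in the type of the
  result.
\<close>

definition l_num :: "'k::field itself \<Rightarrow> nat \<Rightarrow> (nat \<Rightarrow> nat) \<Rightarrow> nat \<Rightarrow> nat" where
  "l_num K n g i =
    (let S = semigroup_gen (g ` {1..n});
         R = semigroup_ring S :: 'k fps ring;
         m = max_ideal n g :: 'k fps set;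
         r = reduction_number R m (fps_X ^ g 1)
     in Max {l. monomial_class S m (apery S (g 1) i + l * g 1)
                \<in> annihilator (assoc_graded R m)
                    (ideal_pow (assoc_graded R m) (graded_max R m) r)})"

end

theory Submission
  imports Defs
begin

text \<open>
  \<open>G\<close> has the classes of the monomials \<open>t\<^sup>s\<close>, \<open>s \<in> S\<close>, as a basis, and \<open>t\<^sup>s t\<^sup>u\<close> is \<open>t\<^sup>s\<^sup>+\<^sup>u\<close> or \<open>0\<close>
  according to whether \<open>ord (s + u) = ord s + ord u\<close>.  Hence \<open>H0\<close> is spanned by the classes with
  exponent in a set \<open>T\<close>, and since the Buchsbaum condition turns its submodules into linear subspaces,
  the length is \<open>card T\<close>.  For \<open>s = \<omega>\<^sub>i + l g\<^sub>1\<close> one has \<open>ord s \<le> a\<^sub>i + l\<close>, with equality for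
  large \<open>l\<close>, and \<open>s \<in> T\<close> iff the inequality is strict.  The defect \<open>a\<^sub>i + l - ord s\<close> never increases with
  \<open>l\<close> and equals \<open>a\<^sub>i - b\<^sub>i\<close> at \<open>l = 0\<close>, so the residue class of \<open>i\<close> contributes the exponents with
  \<open>l \<le> l\<^sub>i\<close> if \<open>a\<^sub>i > b\<^sub>i\<close>, and none otherwise.
\<close>

declare One_nat_def [simp del]

section \<open>Sums of nonzero elements of a numerical semigroup\<close>

locale num_semigroup =
  fixes n :: nat and g :: "nat \<Rightarrow> nat" and S :: "nat set"
  assumes n: "1 \<le> n"
    and g1_pos: "0 < g 1"
    and g1_le: "\<And>j. j \<in> {1..n} \<Longrightarrow> g 1 \<le> g j"
    and gcd: "Gcd (g ` {1..n}) = 1"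
    and S_eq: "S = semigroup_gen (g ` {1..n})"

section \<open>Semigroups generated by a set\<close>

lemma semigroup_gen_add:
  "s \<in> semigroup_gen A \<Longrightarrow> t \<in> semigroup_gen A \<Longrightarrow> s + t \<in> semigroup_gen A"
  by (induction rule: semigroup_gen.induct) (auto simp: add.assoc intro: semigroup_gen.add)

lemma semigroup_gen_mult: "s \<in> semigroup_gen A \<Longrightarrow> k * s \<in> semigroup_gen A"
  by (induction k) (auto intro: semigroup_gen_add semigroup_gen.zero)

lemma semigroup_gen_base: "a \<in> A \<Longrightarrow> a \<in> semigroup_gen A"
  using semigroup_gen.add[OF _ semigroup_gen.zero, of a A] by simp

text \<open>Differences of elements realise the gcd without negative Bezout coefficients: with
  \<open>s = t + Gcd A\<close> and \<open>a * x = Gcd A * y + gcd a (Gcd A)\<close>, the elements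
  \<open>x * a + y * t\<close> and \<open>y * s\<close> differ by the new gcd. For gcd 1 this yields
  two consecutive elements.\<close>

lemma semigroup_gen_Gcd:
  assumes "finite A"
  shows "\<exists>s\<in>semigroup_gen A. \<exists>t\<in>semigroup_gen A. s = t + Gcd A"
  using assms
proof (induction A rule: finite_induct)
  case empty
  then show ?case by (auto intro!: bexI[of _ 0] semigroup_gen.zero)
next
  case (insert a A)
  have mono: "semigroup_gen A \<subseteq> semigroup_gen (insert a A)"
  proof
    fix x assume "x \<in> semigroup_gen A"
    then show "x \<in> semigroup_gen (insert a A)"
      by induction (auto intro: semigroup_gen.intros)
  qed
  obtain s t where st: "s \<in> semigroup_gen A" "t \<in> semigroup_gen A" "s = t + Gcd A"
    using insert.IH by auto
  note S = semigroup_gen_mult[OF subsetD[OF mono st(1)]] semigroup_gen_mult[OF subsetD[OF mono st(2)]]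
    semigroup_gen_mult[OF semigroup_gen_base[of a "insert a A"]]
  show ?case
  proof (cases "a = 0")
    case True
    then show ?thesis using st mono by auto
  next
    case False
    obtain x y where "a * x = Gcd A * y + gcd a (Gcd A)"
      using bezout_nat[OF False] by blast
    then have "x * a + y * t = y * s + Gcd (insert a A)"
      using st(3) by (simp add: algebra_simps)
    moreover have "x * a + y * t \<in> semigroup_gen (insert a A)" "y * s \<in> semigroup_gen (insert a A)"
      by (auto intro!: semigroup_gen_add S)
    ultimately show ?thesis by metis
  qed
qed

context num_semigroup
begin

abbreviation hM :: "nat \<Rightarrow> nat set" where "hM \<equiv> mult_M S"

abbreviation ord :: "nat \<Rightarrow> nat" where "ord \<equiv> order_M S"

abbreviation w :: "nat \<Rightarrow> nat" where "w \<equiv> apery S (g 1)"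

abbreviation w' :: "nat \<Rightarrow> nat" where "w' \<equiv> apery (blowup_semigroup n g) (g 1)"

lemma zero_S [simp]: "0 \<in> S"
  by (simp add: S_eq semigroup_gen.zero)

lemma add_S: "s \<in> S \<Longrightarrow> t \<in> S \<Longrightarrow> s + t \<in> S"
  by (simp add: S_eq semigroup_gen_add)

lemma mult_S: "s \<in> S \<Longrightarrow> k * s \<in> S"
  by (simp add: S_eq semigroup_gen_mult)

lemma g_S: "j \<in> {1..n} \<Longrightarrow> g j \<in> S"
  by (simp add: S_eq semigroup_gen_base)

lemma g_pos: "j \<in> {1..n} \<Longrightarrow> 0 < g j"
  using g1_le[of j] g1_pos by linarith

lemma one_mem [simp]: "1 \<in> {1..n}"
  using n by auto

lemma S_cases:
  assumes "s \<in> S" "s \<noteq> 0"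
  obtains j t where "j \<in> {1..n}" "t \<in> S" "s = g j + t"
  using assms unfolding S_eq by (auto elim: semigroup_gen.cases)

lemma S_ge_g1: "s \<in> S \<Longrightarrow> s \<noteq> 0 \<Longrightarrow> g 1 \<le> s"
  using g1_le by (metis S_cases trans_le_add1)

lemma hM_0 [simp]: "hM 0 = S"
  by (simp add: mult_M_def)

lemma hM_Suc: "hM (Suc h) = {a + b | a b. a \<in> S - {0} \<and> b \<in> hM h}"
proof (cases h)
  case 0
  have h1: "hM (Suc 0) = S - {0}"
    unfolding mult_M_def by (auto simp: length_Suc_conv intro!: exI[of _ "[_]"])
  \<comment> \<open>The convention 0M = \<open>S\<close> rather than {0} sets the first step apart:
    M = M + \<open>S\<close> holds because 0 is in \<open>S\<close>.\<close>
  have "S - {0} = {a + b | a b. a \<in> S - {0} \<and> b \<in> S}"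
  proof (intro equalityI subsetI)
    fix x assume "x \<in> S - {0}"
    then show "x \<in> {a + b | a b. a \<in> S - {0} \<and> b \<in> S}"
      by (intro CollectI exI[of _ x] exI[of _ 0]) auto
  qed (use add_S in auto)
  then show ?thesis unfolding 0 h1 hM_0 .
next
  case (Suc k)
  show ?thesis unfolding mult_M_def Suc
  proof (simp, intro equalityI subsetI; clarsimp)
    fix xs :: "nat list" assume "length xs = Suc (Suc k)" "set xs \<subseteq> S - {0}"
    then obtain y ys where "xs = y # ys" "length ys = Suc k" "set (y # ys) \<subseteq> S - {0}"
      by (cases xs) auto
    then show "\<exists>a b. sum_list xs = a + b \<and> a \<in> S \<and> 0 < a
        \<and> (\<exists>xs. b = sum_list xs \<and> length xs = Suc k \<and> set xs \<subseteq> S - {0})"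
      by (intro exI[of _ y] exI[of _ "sum_list ys"]) auto
  next
    fix a and xs :: "nat list"
    assume "a \<in> S" "0 < a" "length xs = Suc k" "set xs \<subseteq> S - {0}"
    then show "\<exists>ys. a + sum_list xs = sum_list ys \<and> length ys = Suc (Suc k) \<and> set ys \<subseteq> S - {0}"
      by (intro exI[of _ "a # xs"]) auto
  qed
qed

lemma hM_SucE:
  assumes "s \<in> hM (Suc h)"
  obtains c d where "s = c + d" "c \<in> S" "c \<noteq> 0" "d \<in> hM h"
  using assms by (auto simp: hM_Suc)

lemma hM_SucI: "c \<in> S \<Longrightarrow> c \<noteq> 0 \<Longrightarrow> d \<in> hM h \<Longrightarrow> c + d \<in> hM (Suc h)"
  unfolding hM_Suc by blast

lemma hM_add_S: "a \<in> S \<Longrightarrow> b \<in> hM h \<Longrightarrow> a + b \<in> hM h"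
proof (induction h arbitrary: b)
  case (Suc h)
  obtain c d where cd: "b = c + d" "c \<in> S" "c \<noteq> 0" "d \<in> hM h" using Suc.prems by (elim hM_SucE)
  then show ?case using hM_SucI[OF cd(2,3) Suc.IH[of d]] Suc.prems by (simp add: ac_simps)
qed (simp add: add_S)

lemma hM_Suc_subset: "hM (Suc h) \<subseteq> hM h"
  using hM_add_S by (auto simp: hM_Suc)

lemma hM_antimono: "h \<le> k \<Longrightarrow> hM k \<subseteq> hM h"
  using lift_Suc_antimono_le[of hM] hM_Suc_subset by blast

lemma hM_subset_S: "hM h \<subseteq> S"
  using hM_antimono[of 0 h] by simp

lemma hM_add: "a \<in> hM h \<Longrightarrow> b \<in> hM k \<Longrightarrow> a + b \<in> hM (h + k)"
proof (induction h arbitrary: a)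
  case (Suc h)
  obtain c d where cd: "a = c + d" "c \<in> S" "c \<noteq> 0" "d \<in> hM h" using Suc.prems by (elim hM_SucE)
  then show ?case using hM_SucI[OF cd(2,3) Suc.IH[of d]] Suc.prems by (simp add: ac_simps)
qed (simp add: hM_add_S)

text \<open>One nonzero summand contains a generator; what remains of it is absorbed by the other
  summands, as \<open>hM h\<close> is an ideal of \<open>S\<close>.\<close>

lemma hM_Suc_cases:
  assumes "s \<in> hM (Suc h)"
  obtains j t where "j \<in> {1..n}" "t \<in> hM h" "s = g j + t"
proof -
  obtain a b where ab: "s = a + b" "a \<in> S - {0}" "b \<in> hM h" using assms by (auto simp: hM_Suc)
  then obtain j t where "j \<in> {1..n}" "t \<in> S" "a = g j + t" by (auto elim: S_cases)
  then show thesis using ab that[of j "t + b"] by (auto intro: hM_add_S)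
qed

lemma hM_Suc_I: "j \<in> {1..n} \<Longrightarrow> t \<in> hM h \<Longrightarrow> g j + t \<in> hM (Suc h)"
  using g_S g_pos by (auto simp: hM_Suc)

lemma hM_ge: "s \<in> hM h \<Longrightarrow> h * g 1 \<le> s"
proof (induction h arbitrary: s)
  case (Suc h)
  then show ?case using S_ge_g1 by (auto simp: hM_Suc intro!: add_mono)
qed simp

lemma g1_hM: "k * g 1 \<in> hM k"
  using hM_Suc_I[OF one_mem] by (induction k) auto

section \<open>The order of a semigroup element\<close>

lemma hM_ge_index: "s \<in> hM h \<Longrightarrow> h \<le> s"
  using hM_ge[of s h] g1_pos by (metis One_nat_def Suc_leI mult.right_neutral mult_le_mono2 order.trans)

text \<open>Justifies the definite description in \<open>order_M\<close>: the sets
  \<open>hM h\<close> decrease, and only finitely many of them contain \<open>s\<close>, since every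
  nonzero summand is at least 1.\<close>

lemma ord_unique:
  assumes "s \<in> S"
  shows "\<exists>!h. s \<in> hM h - hM (h + 1)"
proof -
  define h where "h = Max {h. s \<in> hM h}"
  have fin: "finite {h. s \<in> hM h}"
    by (rule finite_subset[of _ "{..s}"]) (auto dest: hM_ge_index)
  have "0 \<in> {h. s \<in> hM h}" using assms by simp
  then have "s \<in> hM h" using Max_in[OF fin] unfolding h_def by blast
  moreover have "s \<notin> hM (h + 1)" using Max_ge[OF fin, of "h + 1"] by (auto simp: h_def)
  moreover have "k = h" if "s \<in> hM k" "s \<notin> hM (k + 1)" for k
  proof (rule antisym)
    show "k \<le> h" using Max_ge[OF fin, of k] that by (simp add: h_def)
    show "h \<le> k" using that \<open>s \<in> hM h\<close> hM_antimono[of "k + 1" h] by (cases "h \<le> k") auto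
  qed
  ultimately show ?thesis by blast
qed

lemma mem_hM_iff: "s \<in> S \<Longrightarrow> s \<in> hM h \<longleftrightarrow> h \<le> ord s"
  using theI'[OF ord_unique[of s], folded order_M_def] hM_antimono[of h "ord s"] hM_antimono[of "ord s + 1" h]
  by (metis DiffE Suc_eq_plus1 not_less_eq_eq subsetD)

lemma mem_hM_iff': "s \<in> hM h \<longleftrightarrow> s \<in> S \<and> h \<le> ord s"
  using mem_hM_iff hM_subset_S by blast

text \<open>Superadditivity; equality here is exactly the case in which the product of the two
  classes in the graded ring is nonzero.\<close>

lemma ord_add: "s \<in> S \<Longrightarrow> t \<in> S \<Longrightarrow> ord s + ord t \<le> ord (s + t)"
  using hM_add[of s "ord s" t "ord t"] by (simp add: mem_hM_iff')

lemma ord_ge: "s \<in> S \<Longrightarrow> ord s * g 1 \<le> s"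
  using hM_ge[of s "ord s"] by (simp add: mem_hM_iff')

lemma ord_zero [simp]: "ord 0 = 0"
  using ord_ge[of 0] g1_pos by simp

text \<open>As \<open>g 1\<close> is the least nonzero element, \<open>k * g 1\<close> is too small
  for a sum of more than \<open>k\<close> nonzero elements.\<close>

lemma ord_mult_g1 [simp]: "ord (k * g 1) = k"
proof (rule antisym)
  show "ord (k * g 1) \<le> k"
    using ord_ge[of "k * g 1"] g1_pos mult_S[OF g_S[OF one_mem], of k] by simp
  show "k \<le> ord (k * g 1)"
    using g1_hM[of k] by (simp add: mem_hM_iff')
qed

lemma ord_pos_iff: "s \<in> S \<Longrightarrow> 0 < ord s \<longleftrightarrow> s \<noteq> 0"
  using mem_hM_iff[of s "Suc 0"] hM_SucI[of s 0 0] by (cases "s = 0") (auto simp: Suc_le_eq)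

lemma g1_S [simp]: "g 1 \<in> S" "k * g 1 \<in> S"
  using g_S[OF one_mem] mult_S[of "g 1" k] by auto

section \<open>Apery sets\<close>

lemma S_residue: "\<exists>s\<in>S. [s = i] (mod g 1)"
proof -
  obtain s t where st: "s \<in> S" "t \<in> S" "s = t + 1"
    using semigroup_gen_Gcd[of "g ` {1..n}"] gcd by (auto simp: S_eq)
  \<comment> \<open>\<open>e = g 1 - 1\<close> plays the role of -1 modulo \<open>g 1\<close>, so
    that \<open>i * s + (i * e) * t\<close> is congruent to \<open>i * (s - t) = i\<close>.\<close>
  obtain e where e: "g 1 = Suc e" using g1_pos by (cases "g 1") auto
  have "i * s + (i * e) * t = i + i * t * g 1" using st(3) e by (simp add: algebra_simps)
  moreover have "[i + i * t * g 1 = i] (mod g 1)" by (simp add: cong_def)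
  moreover have "i * s + (i * e) * t \<in> S" using st by (intro add_S mult_S)
  ultimately show ?thesis by metis
qed

lemma S_subset_blowup: "S \<subseteq> blowup_semigroup n g"
proof
  fix s assume "s \<in> S"
  then show "s \<in> blowup_semigroup n g" unfolding S_eq
  proof induction
    case (add a s)
    then obtain j where j: "j \<in> {1..n}" "a = g j" by auto
    have "g j \<in> blowup_semigroup n g"
    proof (cases "j = 1")
      case False
      have "(g j - g 1) + g 1 \<in> blowup_semigroup n g" unfolding blowup_semigroup_def
        by (intro semigroup_gen_add semigroup_gen_base) (use False j in auto)
      then show ?thesis using g1_le[OF j(1)] by simp
    qed (auto simp: blowup_semigroup_def intro: semigroup_gen_base)
    then show ?case using add.IH j unfolding blowup_semigroup_def by (auto intro: semigroup_gen_add)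
  qed (simp add: blowup_semigroup_def semigroup_gen.zero)
qed

lemma w_props: "w i \<in> S" "[w i = i] (mod g 1)"
  using LeastI_ex[of "\<lambda>s. s \<in> S \<and> [s = i] (mod g 1)"] S_residue[of i] by (auto simp: apery_def)

lemma w_le: "s \<in> S \<Longrightarrow> [s = i] (mod g 1) \<Longrightarrow> w i \<le> s"
  unfolding apery_def by (rule Least_le) simp

lemma w'_props: "w' i \<in> blowup_semigroup n g" "[w' i = i] (mod g 1)"
  using LeastI_ex[of "\<lambda>s. s \<in> blowup_semigroup n g \<and> [s = i] (mod g 1)"] S_residue[of i] S_subset_blowup
  by (auto simp: apery_def)

lemma w'_le: "s \<in> blowup_semigroup n g \<Longrightarrow> [s = i] (mod g 1) \<Longrightarrow> w' i \<le> s"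
  unfolding apery_def by (rule Least_le) simp

lemma cong_ge_obtain:
  fixes a b e :: nat
  assumes "[a = b] (mod e)" "b \<le> a"
  obtains l where "a = b + l * e"
proof -
  have "e dvd a - b" using assms by (metis cong_altdef_nat)
  then obtain k where "a - b = e * k" by blast
  then show thesis using that[of k] assms(2) by (simp add: mult.commute)
qed

lemma S_decomp:
  assumes "s \<in> S"
  obtains l where "s = w (s mod g 1) + l * g 1"
  using w_le[OF assms, of "s mod g 1"] w_props(2)[of "s mod g 1"]
  by (metis cong_ge_obtain cong_mod_right cong_refl cong_sym cong_trans)

lemma w_add_mod: "i < g 1 \<Longrightarrow> (w i + l * g 1) mod g 1 = i"
  using w_props(2)[of i] by (simp add: cong_def)

text \<open>\<open>S\<close> is contained in the blowup semigroup, hence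
  \<open>w' i \<le> w i\<close> and the integer a_i is nonnegative.\<close>

lemma a_num_nat: "\<exists>a. a_num n g i = int a \<and> w i = w' i + a * g 1"
proof -
  have "[w i = w' i] (mod g 1)" using w_props(2) w'_props(2) by (meson cong_sym cong_trans)
  moreover have "w' i \<le> w i" using w_props[of i] S_subset_blowup by (intro w'_le) auto
  ultimately obtain a where a: "w i = w' i + a * g 1" by (rule cong_ge_obtain)
  have "a_num n g i = int a" unfolding a_num_def S_eq[symmetric]
    using a g1_pos by (intro the_equality) auto
  then show ?thesis using a by blast
qed

definition a :: "nat \<Rightarrow> nat" where "a i = nat (a_num n g i)"

lemma a_num_eq: "a_num n g i = int (a i)"
  using a_num_nat[of i] by (auto simp: a_def)

lemma w_eq: "w i = w' i + a i * g 1"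
  using a_num_nat[of i] by (auto simp: a_def)

lemma b_num_eq: "b_num n g i = ord (w i)"
proof -
  have "{l. w i \<in> hM l} = {..ord (w i)}" using w_props(1) by (auto simp: mem_hM_iff)
  then show ?thesis unfolding b_num_def S_eq[symmetric] Let_def
    by (simp add: Max_eq_iff)
qed

section \<open>Orders along a residue class, compared with the blowup semigroup\<close>

lemma hM_blowup:
  assumes "s \<in> hM h"
  shows "\<exists>t\<in>blowup_semigroup n g. s = t + h * g 1"
  using assms
proof (induction h arbitrary: s)
  case 0
  then show ?case using S_subset_blowup by auto
next
  case (Suc h)
  then obtain j t where jt: "j \<in> {1..n}" "t \<in> hM h" "s = g j + t" by (auto elim: hM_Suc_cases)
  obtain u where u: "u \<in> blowup_semigroup n g" "t = u + h * g 1" using Suc.IH jt by blast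
  \<comment> \<open>Each summand, taken as a generator, gives up one \<open>g 1\<close>; what is
    left is a generator of the blowup semigroup, or 0 when \<open>j = 1\<close>.\<close>
  have "g j - g 1 + u \<in> blowup_semigroup n g"
  proof (cases "j = 1")
    case False
    then show ?thesis using jt u unfolding blowup_semigroup_def by (intro semigroup_gen.add) auto
  qed (use u in simp)
  moreover have "s = g j - g 1 + u + Suc h * g 1" using jt u g1_le[OF jt(1)] by simp
  ultimately show ?case by blast
qed

text \<open>An asymptotic converse of \<open>hM_blowup\<close>: each summand
  \<open>g j - g 1\<close> becomes a generator of \<open>S\<close> by borrowing one of the
  \<open>k\<close> copies of \<open>g 1\<close>, so \<open>k\<close> has to exceed the number of
  such summands.\<close>

lemma blowup_hM:
  assumes "s \<in> blowup_semigroup n g"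
  shows "\<exists>k0. \<forall>k\<ge>k0. s + k * g 1 \<in> hM k"
  using assms unfolding blowup_semigroup_def
proof induction
  case zero
  then show ?case using g1_hM by auto
next
  case (add b s)
  then obtain k0 where k0: "\<And>k. k \<ge> k0 \<Longrightarrow> s + k * g 1 \<in> hM k" by auto
  show ?case
  proof (cases "b = g 1")
    case True
    then show ?thesis using k0 hM_add_S[OF g1_S(1)] by (auto simp: add.assoc)
  next
    case False
    then have "b \<in> (\<lambda>j. g j - g 1) ` {2..n}" using add.hyps by blast
    then obtain j where "j \<in> {2..n}" "b = g j - g 1" by blast
    then have j: "j \<in> {1..n}" "b = g j - g 1" by auto
    \<comment> \<open>One copy of \<open>g 1\<close> completes \<open>b\<close> to
      \<open>g j\<close>, which raises the threshold by one.\<close>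
    have "b + s + k * g 1 \<in> hM k" if k: "k \<ge> Suc k0" for k
    proof -
      obtain k' where k': "k = Suc k'" "k' \<ge> k0" using k by (cases k) auto
      have eq: "b + s + k * g 1 = g j + (s + k' * g 1)" using j g1_le[OF j(1)] k' by simp
      show ?thesis unfolding eq using hM_Suc_I[OF j(1) k0[OF k'(2)]] k' by simp
    qed
    then show ?thesis by blast
  qed
qed

text \<open>Removing \<open>g 1\<close> once per unit of order leaves an element of the blowup
  semigroup in the same residue class, which is at least \<open>w' i\<close>.\<close>

lemma ord_w_le: "ord (w i + l * g 1) \<le> a i + l"
proof -
  let ?s = "w i + l * g 1"
  have "?s \<in> hM (ord ?s)" using w_props by (simp add: mem_hM_iff add_S)
  then obtain t where t: "t \<in> blowup_semigroup n g" "?s = t + ord ?s * g 1" using hM_blowup by blast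
  have "[t = ?s] (mod g 1)" using t(2) by (metis cong_def mod_mult_self1)
  also have "[?s = i] (mod g 1)" using w_props(2)[of i] by (simp add: cong_def)
  finally have "w' i \<le> t" using w'_le[OF t(1)] by blast
  then have "ord ?s * g 1 \<le> (a i + l) * g 1" using t(2) w_eq[of i] by (simp add: algebra_simps)
  then show ?thesis using g1_pos by simp
qed

text \<open>\<open>blowup_hM\<close> at \<open>w' i\<close>, where
  \<open>w i + l * g 1 = w' i + (a i + l) * g 1\<close>, shows that the bound of
  \<open>ord_w_le\<close> is attained for large \<open>l\<close>; one threshold serves all the
  finitely many residues.\<close>

lemma ord_w_eventually: "\<exists>L. \<forall>i<g 1. \<forall>l\<ge>L. ord (w i + l * g 1) = a i + l"
proof -
  have "\<exists>k0. \<forall>k\<ge>k0. w' i + k * g 1 \<in> hM k" for i using blowup_hM w'_props(1) by blast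
  then obtain K where K: "\<And>i k. K i \<le> k \<Longrightarrow> w' i + k * g 1 \<in> hM k" by metis
  show ?thesis
  proof (intro exI[of _ "Max (K ` {..<g 1})"] allI impI)
    fix i l assume "i < g 1" "Max (K ` {..<g 1}) \<le> l"
    then have "K i \<le> l" using Max_ge[of "K ` {..<g 1}" "K i"] by (meson finite_imageI finite_lessThan
          imageI lessThan_iff order.trans)
    then have "w' i + (a i + l) * g 1 \<in> hM (a i + l)" by (intro K) simp
    moreover have "w' i + (a i + l) * g 1 = w i + l * g 1" using w_eq[of i] by (simp add: algebra_simps)
    ultimately show "ord (w i + l * g 1) = a i + l"
      using ord_w_le[of i l] by (metis antisym mem_hM_iff')
  qed
qed

text \<open>The semigroup form of m^(h+1) = t^(g_1) m^h for large h. Elements of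
  \<open>hM (Suc h)\<close> lie so far along their residue class that the order is
  \<open>a i + l\<close>, so removing one \<open>g 1\<close> costs exactly one unit of
  order.\<close>

lemma ex_reduction: "\<exists>H. \<forall>h\<ge>H. \<forall>s\<in>hM (Suc h). \<exists>t\<in>hM h. s = g 1 + t"
proof -
  obtain L where L: "\<forall>i<g 1. \<forall>l\<ge>L. ord (w i + l * g 1) = a i + l"
    using ord_w_eventually ..
  \<comment> \<open>Chosen so that \<open>s \<ge> H * g 1\<close> forces
    \<open>l \<ge> Suc L\<close>: one \<open>g 1\<close> can then be removed without leaving the
    range where the order is known.\<close>
  define H where "H = Max (w ` {..<g 1}) + Suc L"
  have "\<exists>t\<in>hM h. s = g 1 + t" if h: "H \<le> h" and s: "s \<in> hM (Suc h)" for h s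
  proof -
    have sS: "s \<in> S" using s hM_subset_S by blast
    define i where "i = s mod g 1"
    have i: "i < g 1" using g1_pos by (simp add: i_def)
    obtain l where l: "s = w i + l * g 1" using S_decomp[OF sS] by (auto simp: i_def)
    have "w i \<le> Max (w ` {..<g 1})" using i by simp
    then have wH: "w i + Suc L \<le> H" by (simp add: H_def)
    have "H * g 1 \<le> Suc h * g 1" using h by (intro mult_le_mono1) simp
    also have "\<dots> \<le> w i + l * g 1" using hM_ge[OF s] l by simp
    finally have "(w i + Suc L) * g 1 \<le> w i + l * g 1" using wH by (meson mult_le_mono1 order.trans)
    moreover have "w i \<le> w i * g 1" using g1_pos by simp
    ultimately have "w i + Suc L * g 1 \<le> w i + l * g 1"
      unfolding add_mult_distrib by linarith
    then have "Suc L * g 1 \<le> l * g 1" by (rule add_le_imp_le_left)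
    then have "Suc L \<le> l" using g1_pos by (meson mult_le_cancel2)
    then obtain l' where l': "l = Suc l'" "L \<le> l'" by (cases l) auto
    have "Suc h \<le> ord s" using s sS by (simp add: mem_hM_iff)
    then have "Suc h \<le> a i + l" using L[rule_format, OF i, of l] l l' by simp
    then have "h \<le> ord (w i + l' * g 1)" using L[rule_format, OF i, of l'] l' by simp
    then show ?thesis using l l' w_props(1)[of i] by (intro bexI[of _ "w i + l' * g 1"]) (auto simp: mem_hM_iff' add_S)
  qed
  then show ?thesis by blast
qed

section \<open>The exponents annihilated by high powers\<close>

text \<open>The exponents whose classes are killed by some power of the homogeneous maximal ideal,
  expressed by orders alone; \<open>annihilator_iff\<close> makes the link.\<close>

definition T :: "nat set" where
  "T = {s \<in> S. \<exists>k\<ge>1. \<forall>u\<in>S. k \<le> ord u \<longrightarrow> ord (s + u) \<noteq> ord s + ord u}"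

text \<open>Equivalently, the defect \<open>a i + l - ord (w i + l * g 1)\<close> never increases
  with \<open>l\<close>.\<close>

lemma ord_add_g1: "ord (w i + l * g 1) + k \<le> ord (w i + (l + k) * g 1)"
  using ord_add[of "w i + l * g 1" "k * g 1"] w_props(1)[of i] by (simp add: add_S add_mult_distrib add.assoc)

lemma T_iff:
  assumes i: "i < g 1"
  shows "w i + l * g 1 \<in> T \<longleftrightarrow> ord (w i + l * g 1) < a i + l"
proof
  let ?s = "w i + l * g 1"
  assume "?s \<in> T"
  then obtain k where k: "\<And>u. u \<in> S \<Longrightarrow> k \<le> ord u \<Longrightarrow> ord (?s + u) \<noteq> ord ?s + ord u" by (auto simp: T_def)
  \<comment> \<open>Testing with \<open>u = k * g 1\<close>, of order \<open>k\<close>, makes the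
    order jump by more than \<open>k\<close>; below the bound \<open>a i + l + k\<close> there is
    room for this only if the bound is not attained at \<open>?s\<close>.\<close>
  have "ord (w i + (l + k) * g 1) \<noteq> ord ?s + k" using k[of "k * g 1"] by (simp add: add_mult_distrib add.assoc)
  then show "ord ?s < a i + l" using ord_add_g1[of i l k] ord_w_le[of i "l + k"] by linarith
next
  let ?s = "w i + l * g 1"
  assume less: "ord ?s < a i + l"
  obtain L where L: "\<forall>i<g 1. \<forall>l\<ge>L. ord (w i + l * g 1) = a i + l"
    using ord_w_eventually ..
  obtain H where H: "\<forall>h\<ge>H. \<forall>s\<in>hM (Suc h). \<exists>t\<in>hM h. s = g 1 + t"
    using ex_reduction ..
  \<comment> \<open>Iterating the reduction splits \<open>k\<close> copies of \<open>g 1\<close> off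
    an element of high order at the cost of \<open>k\<close> units of order.\<close>
  have red: "\<exists>t\<in>hM h. u = k * g 1 + t" if "H \<le> h" "u \<in> hM (h + k)" for h k u
    using that
  proof (induction k arbitrary: u)
    case (Suc k)
    then obtain t where t: "t \<in> hM (h + k)" "u = g 1 + t" using H[rule_format, of "h + k" u] by auto
    then show ?case using Suc.IH[of t] Suc.prems by auto
  qed simp
  have sS: "?s \<in> S" using w_props(1) by (simp add: add_S)
  have "ord (?s + u) \<noteq> ord ?s + ord u" if u: "u \<in> S" "Suc H + L \<le> ord u" for u
  proof -
    \<comment> \<open>The \<open>L\<close> copies of \<open>g 1\<close> inside \<open>u\<close> move
      \<open>?s\<close> to where its defect is 0. This gain is missing from
      \<open>ord ?s + ord u\<close>, so the orders do not add.\<close>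
    obtain t where t: "t \<in> hM (ord u - L)" "u = L * g 1 + t"
      using red[of "ord u - L" u L] u by (force simp: mem_hM_iff)
    have tS: "t \<in> S" using t hM_subset_S by blast
    have "ord ?s + ord u < a i + l + L + (ord u - L)" using less u by simp
    also have "\<dots> \<le> ord (w i + (l + L) * g 1) + ord t"
      using L[rule_format, OF i, of "l + L"] t by (simp add: mem_hM_iff')
    also have "\<dots> \<le> ord (?s + u)"
      using ord_add[of "w i + (l + L) * g 1" t] tS w_props(1)[of i] t(2) by (simp add: add_S algebra_simps)
    finally show ?thesis by simp
  qed
  then show "?s \<in> T" unfolding T_def using sS by (auto intro!: exI[of _ "Suc H + L"])
qed

text \<open>By \<open>T_iff\<close> membership means positive defect. Since the defect never
  increases and is finally 0, the admissible \<open>l\<close> form a finite initial segment, empty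
  when the defect already vanishes at \<open>l = 0\<close>.\<close>

lemma T_row:
  assumes i: "i < g 1"
  shows "finite {l. w i + l * g 1 \<in> T}"
    and "ord (w i) < a i \<Longrightarrow> {l. w i + l * g 1 \<in> T} = {..Max {l. w i + l * g 1 \<in> T}}"
    and "\<not> ord (w i) < a i \<Longrightarrow> {l. w i + l * g 1 \<in> T} = {}"
proof -
  let ?X = "{l. w i + l * g 1 \<in> T}"
  obtain L where L: "\<forall>i<g 1. \<forall>l\<ge>L. ord (w i + l * g 1) = a i + l"
    using ord_w_eventually ..
  have "l < L" if "l \<in> ?X" for l using that L[rule_format, OF i, of l] T_iff[OF i, of l]
    by (cases "l < L") auto
  then show fin: "finite ?X" by (meson finite_nat_set_iff_bounded)
  have down: "k \<in> ?X" if "l \<in> ?X" "k \<le> l" for k l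
    using that ord_add_g1[of i k "l - k"] by (simp add: T_iff[OF i])
  show "?X = {..Max ?X}" if "ord (w i) < a i"
  proof -
    have "0 \<in> ?X" using that T_iff[OF i, of 0] by simp
    then have "Max ?X \<in> ?X" using Max_in[OF fin] by blast
    then show ?thesis using down fin by (auto simp del: mem_Collect_eq intro: Max_ge)
  qed
  show "?X = {}" if "\<not> ord (w i) < a i"
    using that down[of _ 0] T_iff[OF i, of 0] by auto
qed

lemma T_subset_S: "T \<subseteq> S"
  by (auto simp: T_def)

lemma T_eq: "T = (\<lambda>(i, l). w i + l * g 1) ` (SIGMA i:{..<g 1}. {l. w i + l * g 1 \<in> T})"
proof (intro equalityI subsetI)
  fix s assume s: "s \<in> T"
  then obtain l where "s = w (s mod g 1) + l * g 1" using S_decomp T_subset_S by blast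
  then show "s \<in> (\<lambda>(i, l). w i + l * g 1) ` (SIGMA i:{..<g 1}. {l. w i + l * g 1 \<in> T})"
    using s g1_pos by (intro image_eqI[of _ _ "(s mod g 1, l)"]) auto
qed auto

lemma T_inj: "inj_on (\<lambda>(i, l). w i + l * g 1) (SIGMA i:{..<g 1}. X i)"
proof (rule inj_onI, clarsimp)
  fix i l j k assume "i < g 1" "j < g 1" and eq: "w i + l * g 1 = w j + k * g 1"
  then have "i = j" using w_add_mod[of i l] w_add_mod[of j k] by simp
  then show "i = j \<and> l = k" using eq g1_pos by simp
qed

lemma finite_T: "finite T"
  by (subst T_eq) (intro finite_imageI finite_SigmaI; simp add: T_row(1))

lemma card_T:
  "card T = (\<Sum>i\<in>{i \<in> {0..g 1 - 1}. a_num n g i > int (b_num n g i)}. Max {l. w i + l * g 1 \<in> T} + 1)"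
proof -
  have "card T = (\<Sum>i<g 1. card {l. w i + l * g 1 \<in> T})"
    by (subst T_eq) (simp add: card_image T_inj T_row(1))
  also have "\<dots> = (\<Sum>i\<in>{i \<in> {..<g 1}. ord (w i) < a i}. card {l. w i + l * g 1 \<in> T})"
    by (rule sum.mono_neutral_right) (use T_row(3) in auto)
  \<comment> \<open>The initial segment starts at 0, hence the summand 1 beyond its maximum.\<close>
  also have "\<dots> = (\<Sum>i\<in>{i \<in> {..<g 1}. ord (w i) < a i}. Max {l. w i + l * g 1 \<in> T} + 1)"
    by (intro sum.cong refl) (subst T_row(2), auto)
  also have "{i \<in> {..<g 1}. ord (w i) < a i} = {i \<in> {0..g 1 - 1}. a_num n g i > int (b_num n g i)}"
    using g1_pos by (auto simp: a_num_eq b_num_eq)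
  finally show ?thesis .
qed

end

section \<open>The powers of the maximal ideal\<close>

text \<open>A concrete model of the powers of the maximal ideal: the series supported in hM, see
  \<open>ideal_pow_max_ideal\<close>.\<close>

definition filt :: "nat set \<Rightarrow> nat \<Rightarrow> 'k::field fps set" where
  "filt S h = {f. \<forall>s. fps_nth f s \<noteq> 0 \<longrightarrow> s \<in> mult_M S h}"

lemma ideal_pow_0: "ideal_pow R I 0 = carrier R"
  by (simp add: ideals_set_def nat_pow_def)

lemma ideal_pow_Suc: "ideal_pow R I (Suc k) = ideal_prod R (ideal_pow R I k) I"
  by (simp add: ideals_set_def nat_pow_def)

declare nat_pow_Suc [simp del] nat_pow_0 [simp del]

context num_semigroup
begin

abbreviation F :: "nat \<Rightarrow> 'k::field fps set" where "F \<equiv> filt S"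

abbreviation R :: "'k::field fps ring" where "R \<equiv> semigroup_ring S"

abbreviation m :: "'k::field fps set" where "m \<equiv> max_ideal n g"

lemma R_simps [simp]:
  "carrier R = F 0" "mult R = (*)" "one R = 1" "zero R = 0" "add R = (+)"
  by (auto simp: semigroup_ring_def filt_def)

section \<open>The filtration by supports\<close>

lemma F_zero: "0 \<in> F h"
  by (simp add: filt_def)

lemma F_add: "f \<in> F h \<Longrightarrow> f' \<in> F h \<Longrightarrow> f + f' \<in> F h"
  by (force simp: filt_def)

lemma F_uminus: "f \<in> F h \<Longrightarrow> - f \<in> F h"
  by (simp add: filt_def)

lemma F_diff: "f \<in> F h \<Longrightarrow> f' \<in> F h \<Longrightarrow> f - f' \<in> F h"
  using F_add[of f h "- f'"] F_uminus[of f' h] by simp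

lemma F_sum: "(\<And>i. i \<in> A \<Longrightarrow> f i \<in> F h) \<Longrightarrow> sum f A \<in> F h"
  by (induction A rule: infinite_finite_induct) (auto simp: F_zero F_add)

lemma F_mult: "f \<in> F h \<Longrightarrow> f' \<in> F k \<Longrightarrow> f * f' \<in> F (h + k)"
proof (clarsimp simp: filt_def)
  fix s assume *: "\<forall>s. fps_nth f s \<noteq> 0 \<longrightarrow> s \<in> hM h" "\<forall>s. fps_nth f' s \<noteq> 0 \<longrightarrow> s \<in> hM k"
    and "fps_nth (f * f') s \<noteq> 0"
  then obtain i where "i \<le> s" "fps_nth f i * fps_nth f' (s - i) \<noteq> 0"
    unfolding fps_mult_nth by (meson atLeastAtMost_iff sum.neutral)
  then show "s \<in> hM (h + k)" using * hM_add[of i h "s - i" k] by auto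
qed

lemma F_antimono: "h \<le> k \<Longrightarrow> F k \<subseteq> F h"
  using hM_antimono by (fastforce simp: filt_def)

lemma F_one: "1 \<in> F 0"
  by (simp add: filt_def)

lemma X_power_F: "s \<in> hM h \<Longrightarrow> fps_X ^ s \<in> F h"
  by (simp add: filt_def fps_X_power_nth)

lemma cring_R: "cring (R :: 'k::field fps ring)"
proof (rule cringI)
  show "abelian_group (R :: 'k fps ring)"
  proof (rule abelian_groupI)
    fix x :: "'k fps" assume "x \<in> carrier R"
    then show "\<exists>y\<in>carrier R. y \<oplus>\<^bsub>R\<^esub> x = \<zero>\<^bsub>R\<^esub>"
      by (intro bexI[of _ "- x"]) (auto simp: F_uminus)
  qed (auto simp: F_add F_zero ac_simps)
  show "comm_monoid (R :: 'k fps ring)"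
    using F_mult[of _ 0 _ 0] by (intro comm_monoidI) (auto simp: F_one ac_simps)
qed (auto simp: algebra_simps)

lemma a_inv_R:
  assumes "f \<in> F 0"
  shows "\<ominus>\<^bsub>R\<^esub> f = - f"
proof -
  interpret cring "R :: 'a fps ring" by (rule cring_R)
  show ?thesis using assms by (intro minus_equality) (auto simp: F_uminus)
qed

lemma ideal_F: "ideal (F h :: 'k::field fps set) R"
proof (rule idealI)
  show "ring (R :: 'k fps ring)" using cring_R cring.axioms(1) by blast
  show "subgroup (F h) (add_monoid (R :: 'k fps ring))"
  proof (rule subgroup.intro)
    fix x :: "'k fps" assume x: "x \<in> F h"
    then show "inv\<^bsub>add_monoid R\<^esub> x \<in> F h"
      using a_inv_R[of x] F_antimono[of 0 h] by (auto simp: a_inv_def F_uminus)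
  qed (use F_antimono[of 0 h] in \<open>auto simp: F_add F_zero\<close>)
qed (use F_mult[of _ 0 _ h] F_mult[of _ h _ 0] in auto)

text \<open>Every exponent of \<open>f\<close> is assigned one generator to split off, and the terms
  of \<open>f\<close> are grouped by that generator. This handles infinite supports at once and
  leaves a finite sum over generators.\<close>

lemma F_Suc_decomp:
  assumes "f \<in> F (Suc h)"
  obtains q where "\<And>j. q j \<in> F h" "f = (\<Sum>j\<in>{1..n}. q j * fps_X ^ g j)"
proof -
  have "\<forall>s\<in>hM (Suc h). \<exists>j. j \<in> {1..n} \<and> g j \<le> s \<and> s - g j \<in> hM h"
    by (metis hM_Suc_cases add_diff_cancel_left' le_add1)
  then obtain J where J: "\<And>s. s \<in> hM (Suc h) \<Longrightarrow> J s \<in> {1..n} \<and> g (J s) \<le> s \<and> s - g (J s) \<in> hM h"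
    by metis
  \<comment> \<open>\<open>q j\<close> collects the terms assigned to \<open>j\<close>, shifted down
    by \<open>g j\<close>.\<close>
  define q where "q j = Abs_fps (\<lambda>s. if s + g j \<in> hM (Suc h) \<and> J (s + g j) = j
    then fps_nth f (s + g j) else 0)" for j
  have "q j \<in> F h" for j using J by (auto simp: filt_def q_def split: if_splits) (metis add_diff_cancel_right')
  moreover have "f = (\<Sum>j\<in>{1..n}. q j * fps_X ^ g j)"
  proof (rule fps_ext)
    fix s
    have "fps_nth (q j * fps_X ^ g j) s = (if J s = j then fps_nth f s else 0)" if "j \<in> {1..n}" for j
      using J[of s] assms by (auto simp: q_def filt_def fps_X_power_mult_right_nth)
    then have "(\<Sum>j\<in>{1..n}. fps_nth (q j * fps_X ^ g j) s)
      = (if J s \<in> {1..n} then fps_nth f s else 0)" by (simp add: sum.delta)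
    also have "\<dots> = fps_nth f s" using J[of s] assms by (auto simp: filt_def)
    finally show "fps_nth f s = fps_nth (\<Sum>j\<in>{1..n}. q j * fps_X ^ g j) s" by (simp add: fps_sum_nth)
  qed
  ultimately show thesis using that by blast
qed

lemma g_hM1: "j \<in> {1..n} \<Longrightarrow> g j \<in> hM 1"
  using hM_Suc_I[of j 0 0] by (simp add: One_nat_def)

text \<open>\<open>F 1\<close> is an ideal containing the generators, and by
  \<open>F_Suc_decomp\<close> with \<open>h = 0\<close> every ideal containing them contains
  \<open>F 1\<close>.\<close>

lemma max_ideal_eq: "(m :: 'k::field fps set) = F 1"
proof
  have "(\<lambda>j. fps_X ^ g j) ` {1..n} \<subseteq> (F 1 :: 'k fps set)" using g_hM1 by (auto intro!: X_power_F)
  then show "m \<subseteq> (F 1 :: 'k fps set)" unfolding max_ideal_def genideal_def S_eq[symmetric] using ideal_F by blast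
  have sub: "F 1 \<subseteq> I" if I: "ideal I R" "(\<lambda>j. fps_X ^ g j) ` {1..n} \<subseteq> I" for I :: "'k fps set"
  proof
    fix f :: "'k fps" assume "f \<in> F 1"
    then obtain q where q: "\<And>j. q j \<in> F 0" "f = (\<Sum>j\<in>{1..n}. q j * fps_X ^ g j)"
      by (metis One_nat_def F_Suc_decomp)
    have "(\<Sum>j\<in>A. q j * fps_X ^ g j) \<in> I" if "A \<subseteq> {1..n}" for A
      using finite_subset[OF that finite_atLeastAtMost] that
    proof (induction A rule: finite_induct)
      case empty
      then show ?case using additive_subgroup.zero_closed[OF ideal.axioms(1)[OF I(1)]] by simp
    next
      case (insert j A)
      then have "q j * fps_X ^ g j \<in> I" using ideal.I_l_closed[OF I(1), of "fps_X ^ g j" "q j"] q(1) I(2)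
        by (simp add: image_subset_iff)
      then show ?case using additive_subgroup.a_closed[OF ideal.axioms(1)[OF I(1)]] insert by auto
    qed
    then show "f \<in> I" using q(2) by simp
  qed
  from sub show "F 1 \<subseteq> (m :: 'k fps set)" unfolding max_ideal_def genideal_def S_eq[symmetric]
    by (intro Inter_greatest) auto
qed

text \<open>Supports add under products, which gives one inclusion; \<open>F_Suc_decomp\<close>
  writes an element of \<open>F (Suc h)\<close> as a finite sum of products and gives the
  other.\<close>

lemma ideal_pow_max_ideal: "ideal_pow R m h = (F h :: 'k::field fps set)"
proof (induction h)
  case 0
  show ?case unfolding ideal_pow_0 by simp
next
  case (Suc h)
  have "ideal_prod R (F h) (F 1) = (F (Suc h) :: 'k fps set)"
  proof (intro equalityI subsetI)
    fix f :: "'k fps" assume "f \<in> ideal_prod R (F h) (F 1)"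
    then show "f \<in> F (Suc h)"
    proof induction
      case (prod i j)
      then show ?case using F_mult[of i h j 1] by (metis R_simps(2) Suc_eq_plus1)
    qed (simp add: F_add)
  next
    fix f :: "'k fps" assume "f \<in> F (Suc h)"
    then obtain q where q: "\<And>j. q j \<in> F h" "f = (\<Sum>j\<in>{1..n}. q j * fps_X ^ g j)"
      by (rule F_Suc_decomp) blast
    have "(\<Sum>j\<in>A. q j * fps_X ^ g j) \<in> ideal_prod R (F h) (F 1)" if "A \<subseteq> {1..n}" for A
      using finite_subset[OF that finite_atLeastAtMost] that
    proof (induction A rule: finite_induct)
      case empty
      then show ?case using ideal_prod.prod[of 0 "F h" 0 "F 1" R] by (simp add: F_zero)
    next
      case (insert j A)
      have "q j * fps_X ^ g j \<in> ideal_prod R (F h) (F 1)"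
        using ideal_prod.prod[of "q j" "F h" "fps_X ^ g j" "F 1" R] q(1) X_power_F[OF g_hM1[of j]] insert by simp
      then show ?case using ideal_prod.sum[of "q j * fps_X ^ g j" R "F h" "F 1"] insert by simp
    qed
    then show "f \<in> ideal_prod R (F h) (F 1)" using q(2) by simp
  qed
  then show ?case unfolding ideal_pow_Suc Suc.IH unfolding max_ideal_eq .
qed

section \<open>Coordinates on the associated graded ring\<close>

abbreviation G :: "(nat \<Rightarrow> 'k::field fps set) ring" where "G \<equiv> assoc_graded R m"

text \<open>The coordinate vectors of elements of \<open>G\<close>; the coordinate at
  \<open>s\<close> belongs to degree \<open>ord s\<close>.\<close>

definition Phi :: "(nat \<Rightarrow> 'k::field) set" where
  "Phi = {\<phi>. finite {s. \<phi> s \<noteq> 0} \<and> (\<forall>s. \<phi> s \<noteq> 0 \<longrightarrow> s \<in> S)}"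

text \<open>The element of \<open>G\<close> whose coordinate at the class of \<open>t\<^sup>s\<close> is \<open>\<phi> s\<close>.\<close>

definition emb :: "(nat \<Rightarrow> 'k::field) \<Rightarrow> nat \<Rightarrow> 'k fps set" where
  "emb \<phi> i = {f \<in> F i. \<forall>s\<in>S. ord s = i \<longrightarrow> fps_nth f s = \<phi> s}"

definition part :: "(nat \<Rightarrow> 'k::field) \<Rightarrow> nat \<Rightarrow> 'k fps" where
  "part \<phi> i = Abs_fps (\<lambda>s. if s \<in> S \<and> ord s = i then \<phi> s else 0)"

text \<open>The product of \<open>G\<close> in coordinates: terms whose orders do not add fall into
  a higher power of m and vanish.\<close>

definition conv :: "(nat \<Rightarrow> 'k::field) \<Rightarrow> (nat \<Rightarrow> 'k) \<Rightarrow> nat \<Rightarrow> 'k" where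
  "conv \<phi> \<psi> s = (\<Sum>v\<in>{0..s}. if v \<in> S \<and> s - v \<in> S \<and> ord v + ord (s - v) = ord s
     then \<phi> v * \<psi> (s - v) else 0)"

definition delta :: "'k::field \<Rightarrow> nat \<Rightarrow> nat \<Rightarrow> 'k" where
  "delta c u = (\<lambda>s. if s = u then c else 0)"

text \<open>Each degree of \<open>G\<close> is finite-dimensional: along each of the finitely many
  residue classes the order eventually grows with \<open>l\<close>. Thus finitely many nonzero
  components mean finitely many nonzero coordinates.\<close>

lemma finite_ord_le: "finite {s \<in> S. ord s \<le> i}"
proof -
  obtain L where L: "\<forall>i<g 1. \<forall>l\<ge>L. ord (w i + l * g 1) = a i + l"
    using ord_w_eventually ..
  have "{s \<in> S. ord s \<le> i} \<subseteq> (\<lambda>(r, l). w r + l * g 1) ` ({..<g 1} \<times> {..L + i})"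
  proof clarify
    fix s assume s: "s \<in> S" "ord s \<le> i"
    obtain l where l: "s = w (s mod g 1) + l * g 1" using S_decomp[OF s(1)] .
    have r: "s mod g 1 < g 1" using g1_pos by simp
    have "l \<le> L + i"
    proof (cases "L \<le> l")
      case True
      then have "ord s = a (s mod g 1) + l" using L r l by metis
      then show ?thesis using s(2) by simp
    qed simp
    then show "s \<in> (\<lambda>(r, l). w r + l * g 1) ` ({..<g 1} \<times> {..L + i})"
      using l r by (intro image_eqI[of _ _ "(s mod g 1, l)"]) auto
  qed
  then show ?thesis by (rule finite_subset) simp
qed

section \<open>Cosets described by coefficients\<close>

lemma fps_nth_F: "f \<in> F h \<Longrightarrow> s \<in> S \<Longrightarrow> ord s < h \<Longrightarrow> fps_nth f s = 0"
  by (force simp: filt_def mem_hM_iff)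

lemma F_I: "(\<And>s. fps_nth f s \<noteq> 0 \<Longrightarrow> s \<in> S \<and> h \<le> ord s) \<Longrightarrow> f \<in> F h"
  by (auto simp: filt_def mem_hM_iff')

lemma F_D: "f \<in> F h \<Longrightarrow> fps_nth f s \<noteq> 0 \<Longrightarrow> s \<in> S \<and> h \<le> ord s"
  by (auto simp: filt_def mem_hM_iff')

lemma F_Suc_I:
  assumes "f \<in> F i" "\<And>s. s \<in> S \<Longrightarrow> ord s = i \<Longrightarrow> fps_nth f s = 0"
  shows "f \<in> F (Suc i)"
proof (rule F_I)
  fix s assume "fps_nth f s \<noteq> 0"
  then show "s \<in> S \<and> Suc i \<le> ord s" using assms(2)[of s] F_D[OF assms(1), of s] by fastforce
qed

text \<open>Two series in \<open>F i\<close> differ by an element of \<open>F (Suc i)\<close>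
  exactly when they agree at the exponents of order \<open>i\<close>.\<close>

lemma coset_eq:
  assumes f: "f \<in> F i"
  shows "F (Suc i) +>\<^bsub>R\<^esub> f = {f' \<in> F i. \<forall>s\<in>S. ord s = i \<longrightarrow> fps_nth f' s = fps_nth f s}"
proof (intro equalityI subsetI)
  fix f' assume "f' \<in> F (Suc i) +>\<^bsub>R\<^esub> f"
  then obtain h where h: "h \<in> F (Suc i)" "f' = h + f" by (auto simp: a_r_coset_def')
  have "h \<in> F i" using h(1) F_antimono[of i "Suc i"] by auto
  then show "f' \<in> {f' \<in> F i. \<forall>s\<in>S. ord s = i \<longrightarrow> fps_nth f' s = fps_nth f s}"
    using h f by (auto simp: F_add fps_nth_F)
next
  fix f' assume f': "f' \<in> {f' \<in> F i. \<forall>s\<in>S. ord s = i \<longrightarrow> fps_nth f' s = fps_nth f s}"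
  have "f' - f \<in> F i" using f' f by (auto intro: F_diff)
  then have "f' - f \<in> F (Suc i)" using f' by (intro F_Suc_I) auto
  then show "f' \<in> F (Suc i) +>\<^bsub>R\<^esub> f" unfolding a_r_coset_def' by (intro UN_I[of "f' - f"]) auto
qed

lemma part_F: "part \<phi> i \<in> F i"
  by (rule F_I) (auto simp: part_def split: if_splits)

lemma emb_eq_coset: "f \<in> emb \<phi> i \<Longrightarrow> emb \<phi> i = F (Suc i) +>\<^bsub>R\<^esub> f"
  by (subst coset_eq) (auto simp: emb_def)

lemma part_emb: "part \<phi> i \<in> emb \<phi> i"
  using part_F by (auto simp: emb_def part_def)

lemma emb_eq_iff: "emb \<phi> = emb \<psi> \<longleftrightarrow> (\<forall>s\<in>S. \<phi> s = \<psi> s)"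
proof
  assume eq: "emb \<phi> = emb \<psi>"
  show "\<forall>s\<in>S. \<phi> s = \<psi> s"
  proof
    fix s assume s: "s \<in> S"
    have "part \<phi> (ord s) \<in> emb \<psi> (ord s)" using part_emb[of \<phi>] by (simp add: eq)
    then show "\<phi> s = \<psi> s" using s by (auto simp: emb_def part_def)
  qed
qed (auto simp: emb_def fun_eq_iff)

lemma emb_zero: "emb (\<lambda>_. 0) i = F (Suc i)"
proof -
  have "0 \<in> emb (\<lambda>_. 0) i" by (simp add: emb_def F_zero)
  from emb_eq_coset[OF this] show ?thesis by (auto simp: a_r_coset_def')
qed

lemma G_simps:
  "zero G = emb (\<lambda>_. 0)"
  "add G = (\<lambda>x y i. x i <+>\<^bsub>R\<^esub> y i)"
  "mult G = (\<lambda>x y k. finsum (R Quot F (Suc k)) (\<lambda>i. rcoset_mult R (F (Suc k)) (x i) (y (k - i))) {..k})"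
  by (auto simp: assoc_graded_def ideal_pow_max_ideal emb_zero fun_eq_iff)

lemma carrier_G: "carrier G = emb ` (Phi :: (nat \<Rightarrow> 'k::field) set)"
proof (intro equalityI subsetI)
  fix x :: "nat \<Rightarrow> 'k fps set" assume "x \<in> carrier G"
  then have x: "\<And>i. \<exists>f\<in>F i. x i = F (Suc i) +>\<^bsub>R\<^esub> f" and fin: "finite {i. x i \<noteq> F (Suc i)}"
    by (auto simp: assoc_graded_def ideal_pow_max_ideal A_RCOSETS_def' a_r_coset_def')
  from x obtain f where f: "\<And>i. f i \<in> F i" "\<And>i. x i = F (Suc i) +>\<^bsub>R\<^esub> f i" by metis
  \<comment> \<open>The coordinate at \<open>s\<close> is read off a representative of the only
    component that sees it, the one of degree \<open>ord s\<close>.\<close>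
  define \<phi> where "\<phi> s = (if s \<in> S then fps_nth (f (ord s)) s else 0)" for s
  have femb: "f i \<in> emb \<phi> i" for i using f(1) by (auto simp: emb_def \<phi>_def)
  have x_emb: "x = emb \<phi>" using f(2) emb_eq_coset[OF femb] by (auto simp: fun_eq_iff)
  have "finite {s. \<phi> s \<noteq> 0}"
  proof (rule finite_subset)
    show "{s. \<phi> s \<noteq> 0} \<subseteq> (\<Union>i\<in>{i. x i \<noteq> F (Suc i)}. {s \<in> S. ord s \<le> i})"
    proof
      fix s assume "s \<in> {s. \<phi> s \<noteq> 0}"
      then have s: "s \<in> S" "fps_nth (f (ord s)) s \<noteq> 0" by (auto simp: \<phi>_def split: if_splits)
      have "f (ord s) \<in> x (ord s)" using femb x_emb by simp
      moreover have "f (ord s) \<notin> F (Suc (ord s))" using s fps_nth_F by blast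
      ultimately show "s \<in> (\<Union>i\<in>{i. x i \<noteq> F (Suc i)}. {s \<in> S. ord s \<le> i})" using s by blast
    qed
    show "finite (\<Union>i\<in>{i. x i \<noteq> F (Suc i)}. {s \<in> S. ord s \<le> i})" using fin finite_ord_le by blast
  qed
  then have "\<phi> \<in> Phi" unfolding Phi_def by (simp add: \<phi>_def)
  then show "x \<in> emb ` Phi" using x_emb by blast
next
  fix x :: "nat \<Rightarrow> 'k fps set" assume "x \<in> emb ` Phi"
  then obtain \<phi> where \<phi>: "\<phi> \<in> Phi" "x = emb \<phi>" by blast
  have "{i. emb \<phi> i \<noteq> F (Suc i)} \<subseteq> ord ` {s. \<phi> s \<noteq> 0}"
  proof (rule subsetI, rule ccontr)
    fix i assume "i \<in> {i. emb \<phi> i \<noteq> F (Suc i)}" and i: "i \<notin> ord ` {s. \<phi> s \<noteq> 0}"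
    then have ne: "emb \<phi> i \<noteq> F (Suc i)" by simp
    from i have "\<phi> s = 0" if "ord s = i" for s using that by blast
    then have "emb \<phi> i = emb (\<lambda>_. 0) i" by (simp add: emb_def)
    with ne show False by (simp add: emb_zero)
  qed
  then have "finite {i. emb \<phi> i \<noteq> F (Suc i)}"
    by (rule finite_subset) (use \<phi>(1) in \<open>simp add: Phi_def\<close>)
  moreover have "\<exists>f\<in>F i. emb \<phi> i = F (Suc i) +>\<^bsub>R\<^esub> f" for i
    using part_F[of \<phi> i] emb_eq_coset[OF part_emb[of \<phi> i]] by blast
  ultimately show "x \<in> carrier G" unfolding \<phi>(2)
    by (auto simp: assoc_graded_def ideal_pow_max_ideal A_RCOSETS_def' a_r_coset_def')
qed

section \<open>The ring operations in coordinates\<close>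

lemma emb_add:
  fixes \<phi> \<psi> :: "nat \<Rightarrow> 'k::field"
  shows "emb \<phi> \<oplus>\<^bsub>G\<^esub> emb \<psi> = emb (\<lambda>s. \<phi> s + \<psi> s)"
proof
  fix i
  have F0: "F i \<subseteq> (F 0 :: 'k fps set)" by (rule F_antimono) simp
  have sum: "part \<phi> i + part \<psi> i \<in> emb (\<lambda>s. \<phi> s + \<psi> s) i"
    using part_F[of \<phi> i] part_F[of \<psi> i] by (auto simp: emb_def F_add part_def)
  show "(emb \<phi> \<oplus>\<^bsub>G\<^esub> emb \<psi>) i = emb (\<lambda>s. \<phi> s + \<psi> s) i"
    unfolding G_simps emb_eq_coset[OF sum] emb_eq_coset[OF part_emb[of \<phi> i]] emb_eq_coset[OF part_emb[of \<psi> i]]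
    using ideal.a_rcos_sum[OF ideal_F[of "Suc i"], of "part \<phi> i" "part \<psi> i"] part_F F0 by auto
qed

text \<open>\<open>rcoset_mult\<close> is a union over all representatives; they all give the same
  coset because \<open>f * f' - p * p' = (f - p) * f' + p * (f' - p')\<close> and both terms lie in
  \<open>F (Suc k)\<close>.\<close>

lemma rcoset_mult_emb:
  assumes "i \<le> k"
  shows "rcoset_mult R (F (Suc k)) (emb \<phi> i) (emb \<psi> (k - i))
    = F (Suc k) +>\<^bsub>R\<^esub> (part \<phi> i * part \<psi> (k - i))"
proof -
  have "F (Suc k) +>\<^bsub>R\<^esub> (f * f') = F (Suc k) +>\<^bsub>R\<^esub> (part \<phi> i * part \<psi> (k - i))"
    if f: "f \<in> emb \<phi> i" "f' \<in> emb \<psi> (k - i)" for f f'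
  proof -
    have fF: "f \<in> F i" "f' \<in> F (k - i)" using f by (auto simp: emb_def)
    have "f - part \<phi> i \<in> F i" "f' - part \<psi> (k - i) \<in> F (k - i)" using fF part_F by (auto intro: F_diff)
    then have "f - part \<phi> i \<in> F (Suc i)" "f' - part \<psi> (k - i) \<in> F (Suc (k - i))"
      using f by (auto intro!: F_Suc_I simp: emb_def part_def)
    then have "(f - part \<phi> i) * f' \<in> F (Suc k)" "part \<phi> i * (f' - part \<psi> (k - i)) \<in> F (Suc k)"
      using F_mult[of _ "Suc i" f' "k - i"] F_mult[of "part \<phi> i" i _ "Suc (k - i)"] fF part_F assms by auto
    from F_add[OF this] have diff: "f * f' - part \<phi> i * part \<psi> (k - i) \<in> F (Suc k)"
      by (simp add: algebra_simps)
    have "f * f' \<in> F k" "part \<phi> i * part \<psi> (k - i) \<in> F k"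
      using F_mult[OF fF] F_mult[OF part_F[of \<phi> i] part_F[of \<psi> "k - i"]] assms by simp_all
    moreover have "fps_nth (f * f') s = fps_nth (part \<phi> i * part \<psi> (k - i)) s" if "s \<in> S" "ord s = k" for s
      using fps_nth_F[OF diff that(1)] that(2) by simp
    ultimately show ?thesis by (simp add: coset_eq)
  qed
  then have "rcoset_mult R (F (Suc k)) (emb \<phi> i) (emb \<psi> (k - i))
    = (\<Union>f\<in>emb \<phi> i. \<Union>f'\<in>emb \<psi> (k - i). F (Suc k) +>\<^bsub>R\<^esub> (part \<phi> i * part \<psi> (k - i)))"
    unfolding rcoset_mult_def by (intro SUP_cong refl) simp
  moreover have "emb \<phi> i \<noteq> {}" "emb \<psi> (k - i) \<noteq> {}" using part_emb by blast+
  ultimately show ?thesis by simp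
qed

text \<open>After swapping the sums, only \<open>i = ord v\<close> contributes for a given
  \<open>v\<close>, and then \<open>k - i\<close> is the order of \<open>s - v\<close> exactly when
  the orders add.\<close>

lemma sum_part_nth:
  assumes s: "ord s = k"
  shows "(\<Sum>i\<le>k. fps_nth (part \<phi> i * part \<psi> (k - i)) s) = conv \<phi> \<psi> s"
proof -
  have "(\<Sum>i\<le>k. fps_nth (part \<phi> i * part \<psi> (k - i)) s)
    = (\<Sum>v\<in>{0..s}. \<Sum>i\<le>k. fps_nth (part \<phi> i) v * fps_nth (part \<psi> (k - i)) (s - v))"
    unfolding fps_mult_nth by (rule sum.swap)
  also have "\<dots> = conv \<phi> \<psi> s" unfolding conv_def
  proof (rule sum.cong[OF refl])
    fix v assume "v \<in> {0..s}"
    have "(\<Sum>i\<le>k. fps_nth (part \<phi> i) v * fps_nth (part \<psi> (k - i)) (s - v))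
      = (\<Sum>i\<le>k. if i = ord v then (if v \<in> S \<and> s - v \<in> S \<and> ord v + ord (s - v) = ord s
          then \<phi> v * \<psi> (s - v) else 0) else 0)"
      by (rule sum.cong[OF refl]) (use s in \<open>auto simp: part_def\<close>)
    also have "\<dots> = (if v \<in> S \<and> s - v \<in> S \<and> ord v + ord (s - v) = ord s
      then \<phi> v * \<psi> (s - v) else 0)" using s by (auto simp: sum.delta)
    finally show "(\<Sum>i\<le>k. fps_nth (part \<phi> i) v * fps_nth (part \<psi> (k - i)) (s - v))
      = (if v \<in> S \<and> s - v \<in> S \<and> ord v + ord (s - v) = ord s then \<phi> v * \<psi> (s - v) else 0)" .
  qed
  finally show ?thesis .
qed

lemma finsum_R:
  fixes f :: "'i \<Rightarrow> 'k::field fps"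
  assumes "\<And>i. i \<in> A \<Longrightarrow> f i \<in> F 0"
  shows "finsum R f A = sum f A"
proof -
  interpret cring "R :: 'k fps ring" by (rule cring_R)
  show ?thesis using assms
    by (induction A rule: infinite_finite_induct) auto
qed

lemma emb_mult:
  fixes \<phi> \<psi> :: "nat \<Rightarrow> 'k::field"
  shows "emb \<phi> \<otimes>\<^bsub>G\<^esub> emb \<psi> = emb (conv \<phi> \<psi>)"
proof
  fix k
  let ?p = "\<lambda>i. part \<phi> i * part \<psi> (k - i)"
  \<comment> \<open>The sum in the quotient ring is the image of a sum of representatives in
    \<open>R\<close>.\<close>
  interpret ring_hom_cring R "R Quot F (Suc k)" "(+>\<^bsub>R\<^esub>) (F (Suc k) :: 'k fps set)"
    by (rule ideal.rcos_ring_hom_cring[OF ideal_F cring_R])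
  have pk: "?p i \<in> F k" if "i \<le> k" for i
    using F_mult[OF part_F[of \<phi> i] part_F[of \<psi> "k - i"]] that by simp
  have p0: "?p i \<in> F 0" if "i \<le> k" for i using pk[OF that] F_antimono[of 0 k] by auto
  have "(emb \<phi> \<otimes>\<^bsub>G\<^esub> emb \<psi>) k = finsum (R Quot F (Suc k)) (\<lambda>i. F (Suc k) +>\<^bsub>R\<^esub> ?p i) {..k}"
    unfolding G_simps
    by (rule S.finsum_cong') (use p0 hom_closed in \<open>auto simp: rcoset_mult_emb\<close>)
  also have "\<dots> = F (Suc k) +>\<^bsub>R\<^esub> finsum R ?p {..k}"
    using hom_finsum[of ?p "{..k}"] p0 by (auto simp: o_def)
  also have "finsum R ?p {..k} = sum ?p {..k}" using p0 by (intro finsum_R) auto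
  also have "F (Suc k) +>\<^bsub>R\<^esub> sum ?p {..k} = emb (conv \<phi> \<psi>) k"
    by (rule emb_eq_coset[symmetric]) (auto simp: emb_def fps_sum_nth sum_part_nth intro!: F_sum pk)
  finally show "(emb \<phi> \<otimes>\<^bsub>G\<^esub> emb \<psi>) k = emb (conv \<phi> \<psi>) k" .
qed

lemma conv_delta_right:
  assumes "u \<in> S"
  shows "conv \<phi> (delta c u) s
    = (if u \<le> s \<and> s - u \<in> S \<and> ord (s - u) + ord u = ord s then \<phi> (s - u) * c else 0)"
proof -
  have "conv \<phi> (delta c u) s = (\<Sum>v\<in>{0..s}. if v = s - u then
      (if u \<le> s \<and> s - u \<in> S \<and> ord (s - u) + ord u = ord s then \<phi> (s - u) * c else 0) else 0)"
    unfolding conv_def by (rule sum.cong[OF refl]) (use assms in \<open>auto simp: delta_def\<close>)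
  then show ?thesis by simp
qed

lemma conv_nonzero:
  assumes "conv \<phi> \<psi> s \<noteq> 0"
  obtains u v where "s = u + v" "u \<in> S" "v \<in> S" "ord (u + v) = ord u + ord v" "\<phi> u \<noteq> 0" "\<psi> v \<noteq> 0"
proof -
  obtain v where v: "v \<in> {0..s}" "(if v \<in> S \<and> s - v \<in> S \<and> ord v + ord (s - v) = ord s
     then \<phi> v * \<psi> (s - v) else 0) \<noteq> 0"
    using assms unfolding conv_def by (rule sum.not_neutral_contains_not_neutral)
  then show thesis using that[of v "s - v"] by (auto split: if_splits)
qed

lemma conv_Phi:
  assumes "\<phi> \<in> Phi" "\<psi> \<in> Phi"
  shows "conv \<phi> \<psi> \<in> Phi"
proof -
  have "{s. conv \<phi> \<psi> s \<noteq> 0} \<subseteq> (\<lambda>(u, v). u + v) ` ({s. \<phi> s \<noteq> 0} \<times> {s. \<psi> s \<noteq> 0})"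
    by (auto elim!: conv_nonzero)
  moreover have "finite ((\<lambda>(u, v). u + v) ` ({s. \<phi> s \<noteq> 0} \<times> {s. \<psi> s \<noteq> 0}))"
    using assms by (auto simp: Phi_def)
  ultimately have "finite {s. conv \<phi> \<psi> s \<noteq> 0}" by (rule finite_subset)
  then show ?thesis by (auto simp: Phi_def elim!: conv_nonzero intro: add_S)
qed

lemma delta_Phi: "u \<in> S \<Longrightarrow> delta c u \<in> Phi"
  by (auto simp: Phi_def delta_def split: if_splits)

lemma monomial_class_eq:
  assumes s: "s \<in> S"
  shows "monomial_class S m s = emb (delta (1 :: 'k::field) s)"
proof
  fix i
  show "monomial_class S m s i = emb (delta (1 :: 'k) s) i"
  proof (cases "i = ord s")
    case True
    have "fps_X ^ s \<in> emb (delta (1 :: 'k) s) i" using s True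
      by (auto simp: emb_def delta_def fps_X_power_nth mem_hM_iff intro!: X_power_F)
    from emb_eq_coset[OF this] show ?thesis using True
      by (simp add: monomial_class_def ideal_pow_max_ideal)
  next
    case False
    then have "emb (delta (1 :: 'k) s) i = emb (\<lambda>_. 0) i" by (auto simp: emb_def delta_def)
    then show ?thesis using False by (simp add: monomial_class_def ideal_pow_max_ideal emb_zero)
  qed
qed

section \<open>The zeroth local cohomology\<close>

abbreviation MM :: "(nat \<Rightarrow> 'k::field fps set) set" where "MM \<equiv> graded_max R m"

section \<open>Powers of the homogeneous maximal ideal and their annihilators\<close>

lemma emb_component: "emb \<phi> i = emb \<psi> i \<Longrightarrow> s \<in> S \<Longrightarrow> ord s = i \<Longrightarrow> \<phi> s = \<psi> s"
  using part_emb[of \<phi> i] by (auto simp: emb_def part_def)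

lemma MM_E:
  assumes "x \<in> MM"
  obtains \<phi> where "\<phi> \<in> Phi" "x = emb \<phi>" "\<phi> 0 = 0"
proof -
  obtain \<phi> where \<phi>: "\<phi> \<in> Phi" "x = emb \<phi>" and "emb \<phi> 0 = emb (\<lambda>_. 0) 0"
    using assms by (auto simp: graded_max_def carrier_G G_simps)
  then have "\<phi> 0 = 0" using emb_component[of \<phi> 0 "\<lambda>_. 0" 0] by simp
  then show thesis using that \<phi> by blast
qed

lemma MM_delta:
  assumes "u \<in> S" "u \<noteq> 0"
  shows "emb (delta c u) \<in> MM"
proof -
  have "ord u \<noteq> 0" using ord_pos_iff[OF assms(1)] assms(2) by simp
  then have "emb (delta c u) 0 = emb (\<lambda>_. 0) 0" by (auto simp: emb_def delta_def)
  then show ?thesis using assms delta_Phi by (auto simp: graded_max_def carrier_G G_simps)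
qed

lemma conv_delta_delta:
  assumes "u \<in> S" "v \<in> S" "ord (u + v) = ord u + ord v"
  shows "conv (delta 1 u) (delta 1 v) = delta 1 (u + v)"
  using assms by (auto simp: fun_eq_iff conv_delta_right) (auto simp: delta_def)

text \<open>Splitting off one generator at a time factors the class of t^u into classes of
  generators, as many as the order of \<open>u\<close>.\<close>

lemma MM_pow_delta:
  assumes "u \<in> S" "k \<le> ord u"
  shows "emb (delta (1 :: 'k::field) u) \<in> ideal_pow G MM k"
  using assms
proof (induction k arbitrary: u)
  case 0
  then show ?case unfolding ideal_pow_0 carrier_G by (simp add: delta_Phi)
next
  case (Suc k)
  then obtain h where h: "ord u = Suc h" "k \<le> h" by (cases "ord u") auto
  then have "u \<in> hM (Suc h)" using Suc.prems by (simp add: mem_hM_iff)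
  then obtain j t where jt: "j \<in> {1..n}" "t \<in> hM h" "u = g j + t" by (rule hM_Suc_cases)
  have t: "t \<in> S" "h \<le> ord t" using jt(2) by (auto simp: mem_hM_iff')
  have j: "g j \<in> S" "1 \<le> ord (g j)" using g_hM1[OF jt(1)] by (auto simp: mem_hM_iff')
  \<comment> \<open>Superadditivity leaves no slack: the two orders are at least \<open>h\<close>
    and 1, while the order of the sum is \<open>Suc h\<close>.\<close>
  have "ord (t + g j) = ord t + ord (g j)"
    using ord_add[OF t(1) j(1)] t(2) j(2) h jt(3) by (simp add: add.commute)
  then have "emb (delta 1 t) \<otimes>\<^bsub>G\<^esub> emb (delta 1 (g j)) = emb (delta (1 :: 'k) u)"
    unfolding emb_mult using jt(3) by (simp add: conv_delta_delta[OF t(1) j(1)] add.commute)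
  moreover have "emb (delta (1 :: 'k) t) \<in> ideal_pow G MM k" using Suc.IH t h by simp
  moreover have "emb (delta (1 :: 'k) (g j)) \<in> MM" using MM_delta[OF j(1)] g_pos[OF jt(1)] by simp
  ultimately show ?case unfolding ideal_pow_Suc by (metis ideal_prod.prod)
qed

text \<open>A nonzero product of basis classes adds orders, and elements of \<open>MM\<close>
  involve only nonzero exponents, which have positive order.\<close>

lemma MM_pow_E:
  assumes "x \<in> ideal_pow G MM k"
  shows "\<exists>\<phi>\<in>Phi. x = emb \<phi> \<and> (\<forall>s. \<phi> s \<noteq> 0 \<longrightarrow> k \<le> ord s)"
  using assms
proof (induction k arbitrary: x)
  case 0
  then show ?case unfolding ideal_pow_0 carrier_G by auto
next
  case (Suc k)
  from Suc.prems show ?case unfolding ideal_pow_Suc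
  proof (induction rule: ideal_prod.induct)
    case (prod x y)
    obtain \<phi> where \<phi>: "\<phi> \<in> Phi" "x = emb \<phi>" "\<forall>s. \<phi> s \<noteq> 0 \<longrightarrow> k \<le> ord s"
      using Suc.IH[OF prod(1)] by blast
    obtain \<psi> where \<psi>: "\<psi> \<in> Phi" "y = emb \<psi>" "\<psi> 0 = 0" using prod(2) by (rule MM_E)
    have "Suc k \<le> ord s" if nz: "conv \<phi> \<psi> s \<noteq> 0" for s
    proof -
      obtain u v where uv: "s = u + v" "u \<in> S" "v \<in> S" "ord (u + v) = ord u + ord v" "\<phi> u \<noteq> 0" "\<psi> v \<noteq> 0"
        using nz by (rule conv_nonzero)
      have "v \<noteq> 0" using uv \<psi>(3) by metis
      then have "0 < ord v" using uv(3) ord_pos_iff by blast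
      moreover have "k \<le> ord u" using uv(5) \<phi>(3) by blast
      ultimately show ?thesis using uv(1,4) by simp
    qed
    then show ?case unfolding \<phi>(2) \<psi>(2) emb_mult using conv_Phi[OF \<phi>(1) \<psi>(1)] by blast
  next
    case (sum x y)
    then obtain \<phi> \<psi> where
      \<phi>: "\<phi> \<in> Phi" "x = emb \<phi>" "\<forall>s. \<phi> s \<noteq> 0 \<longrightarrow> Suc k \<le> ord s" and
      \<psi>: "\<psi> \<in> Phi" "y = emb \<psi>" "\<forall>s. \<psi> s \<noteq> 0 \<longrightarrow> Suc k \<le> ord s" by blast
    have "finite ({s. \<phi> s \<noteq> 0} \<union> {s. \<psi> s \<noteq> 0})" using \<phi>(1) \<psi>(1) by (simp add: Phi_def)
    then have "finite {s. \<phi> s + \<psi> s \<noteq> 0}" by (rule rev_finite_subset) auto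
    moreover have "s \<in> S \<and> Suc k \<le> ord s" if "\<phi> s + \<psi> s \<noteq> 0" for s
    proof (cases "\<phi> s = 0")
      case True
      then show ?thesis using that \<psi> by (simp add: Phi_def)
    qed (use \<phi> in \<open>simp add: Phi_def\<close>)
    ultimately have "(\<lambda>s. \<phi> s + \<psi> s) \<in> Phi \<and> (\<forall>s. \<phi> s + \<psi> s \<noteq> 0 \<longrightarrow> Suc k \<le> ord s)"
      by (simp add: Phi_def)
    then show ?case unfolding \<phi>(2) \<psi>(2) emb_add by blast
  qed
qed

text \<open>Multiplying by the class of t^u puts the single term \<open>\<phi> s\<close> at the
  coordinate \<open>s + u\<close>, so there is no cancellation and annihilation is decided one
  exponent at a time.\<close>

lemma annihilator_iff:
  fixes \<phi> :: "nat \<Rightarrow> 'k::field"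
  assumes "\<phi> \<in> Phi"
  shows "emb \<phi> \<in> annihilator G (ideal_pow G MM k)
    \<longleftrightarrow> (\<forall>s u. \<phi> s \<noteq> 0 \<longrightarrow> u \<in> S \<longrightarrow> k \<le> ord u \<longrightarrow> ord (s + u) \<noteq> ord s + ord u)"
    (is "?L \<longleftrightarrow> ?R")
proof
  assume L: ?L
  show ?R
  proof (intro allI impI notI)
    fix s u assume su: "\<phi> s \<noteq> 0" "u \<in> S" "k \<le> ord u" "ord (s + u) = ord s + ord u"
    have s: "s \<in> S" using su(1) assms by (simp add: Phi_def)
    have "emb (delta (1 :: 'k) u) \<in> ideal_pow G MM k" using su(2,3) by (rule MM_pow_delta)
    then have "emb \<phi> \<otimes>\<^bsub>G\<^esub> emb (delta 1 u) = \<zero>\<^bsub>G\<^esub>"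
      using L by (simp add: annihilator_def)
    then have "conv \<phi> (delta 1 u) (s + u) = 0"
      unfolding emb_mult G_simps(1) emb_eq_iff using add_S[OF s su(2)] by simp
    then show False using su s by (simp add: conv_delta_right)
  qed
next
  assume R: ?R
  have "emb \<phi> \<otimes>\<^bsub>G\<^esub> y = \<zero>\<^bsub>G\<^esub>" if y: "y \<in> ideal_pow G MM k" for y
  proof -
    obtain \<psi> where \<psi>: "\<psi> \<in> Phi" "y = emb \<psi>" "\<forall>s. \<psi> s \<noteq> 0 \<longrightarrow> k \<le> ord s" using MM_pow_E[OF y] by blast
    have "conv \<phi> \<psi> s = 0" for s
    proof (rule ccontr)
      assume "conv \<phi> \<psi> s \<noteq> 0"
      then obtain u v where "s = u + v" "u \<in> S" "v \<in> S" "ord (u + v) = ord u + ord v" "\<phi> u \<noteq> 0" "\<psi> v \<noteq> 0"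
        by (rule conv_nonzero)
      then show False using R \<psi>(3) by blast
    qed
    then show ?thesis unfolding \<psi>(2) emb_mult G_simps(1) emb_eq_iff by simp
  qed
  then show ?L using assms by (simp add: annihilator_def carrier_G)
qed

section \<open>The zeroth local cohomology as the span of the classes with exponent in
  \<open>T\<close>\<close>

definition PhiT :: "(nat \<Rightarrow> 'k::field) set" where
  "PhiT = {\<phi>. \<forall>s. \<phi> s \<noteq> 0 \<longrightarrow> s \<in> T}"

lemma PhiT_Phi: "\<phi> \<in> PhiT \<Longrightarrow> \<phi> \<in> Phi"
proof -
  assume \<phi>: "\<phi> \<in> PhiT"
  then have "{s. \<phi> s \<noteq> 0} \<subseteq> T" by (auto simp: PhiT_def)
  then show ?thesis using finite_T T_subset_S by (auto simp: Phi_def intro: finite_subset)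
qed

lemma H0_eq: "H0 G MM = emb ` (PhiT :: (nat \<Rightarrow> 'k::field) set)"
proof (intro equalityI subsetI)
  fix x :: "nat \<Rightarrow> 'k fps set" assume "x \<in> H0 G MM"
  then obtain k where k: "k \<ge> 1" "x \<in> annihilator G (ideal_pow G MM k)" by (auto simp: H0_def)
  then obtain \<phi> where \<phi>: "\<phi> \<in> Phi" "x = emb \<phi>" by (auto simp: annihilator_def carrier_G)
  have "s \<in> T" if "\<phi> s \<noteq> 0" for s
    unfolding T_def using k \<phi> that annihilator_iff[OF \<phi>(1), of k] by (auto simp: Phi_def)
  then show "x \<in> emb ` PhiT" using \<phi> by (auto simp: PhiT_def)
next
  fix x :: "nat \<Rightarrow> 'k fps set" assume "x \<in> emb ` PhiT"
  then obtain \<phi> where \<phi>: "\<phi> \<in> PhiT" "x = emb \<phi>" by auto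
  have "\<forall>s\<in>T. \<exists>k. \<forall>u\<in>S. k \<le> ord u \<longrightarrow> ord (s + u) \<noteq> ord s + ord u" unfolding T_def by blast
  then obtain K where K: "\<And>s u. s \<in> T \<Longrightarrow> u \<in> S \<Longrightarrow> K s \<le> ord u \<Longrightarrow> ord (s + u) \<noteq> ord s + ord u"
    by metis
  \<comment> \<open>Since \<open>T\<close> is finite, one power works for all its exponents;
    \<open>Suc\<close> ensures \<open>k \<ge> 1\<close>.\<close>
  define k where "k = Suc (sum K T)"
  have "K s \<le> k" if "s \<in> T" for s using member_le_sum[OF that, of K] finite_T by (simp add: k_def)
  then have "ord (s + u) \<noteq> ord s + ord u" if "\<phi> s \<noteq> 0" "u \<in> S" "k \<le> ord u" for s u
    using K[of s u] that \<phi>(1) by (auto simp: PhiT_def intro: order.trans)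
  then have "x \<in> annihilator G (ideal_pow G MM k)"
    unfolding \<phi>(2) using annihilator_iff[OF PhiT_Phi[OF \<phi>(1)]] by blast
  then show "x \<in> H0 G MM" by (auto simp: H0_def k_def)
qed

lemma delta_PhiT: "s \<in> T \<Longrightarrow> delta c s \<in> PhiT"
  by (auto simp: PhiT_def delta_def)

text \<open>If the orders added, the class of t^(u + s) would be a nonzero product of an element of
  \<open>MM\<close> and one of \<open>H0 G MM\<close>.\<close>

lemma buchsbaum_T:
  assumes B: "buchsbaum G (MM :: (nat \<Rightarrow> 'k::field fps set) set)"
    and s: "s \<in> T" and u: "u \<in> S" "u \<noteq> 0"
  shows "ord (u + s) \<noteq> ord u + ord s"
proof
  assume eq: "ord (u + s) = ord u + ord s"
  have sS: "s \<in> S" using s T_subset_S by blast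
  have "emb (delta (1 :: 'k) u) \<otimes>\<^bsub>G\<^esub> emb (delta 1 s) \<in> ideal_prod G MM (H0 G MM)"
    by (rule ideal_prod.prod) (use MM_delta[OF u] delta_PhiT[OF s] in \<open>auto simp: H0_eq\<close>)
  then have "emb (delta (1 :: 'k) (u + s)) = \<zero>\<^bsub>G\<^esub>"
    using B by (simp add: buchsbaum_def emb_mult conv_delta_delta[OF u(1) sS eq])
  then have "delta (1 :: 'k) (u + s) (u + s) = 0"
    unfolding G_simps(1) emb_eq_iff using add_S[OF u(1) sS] by simp
  then show False by (simp add: delta_def)
qed

text \<open>By \<open>buchsbaum_T\<close> only the term with \<open>v = 0\<close> survives:
  \<open>G\<close> acts on \<open>H0 G MM\<close> through its degree 0 part, that is, through
  scalars.\<close>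

lemma conv_PhiT:
  fixes \<phi> :: "nat \<Rightarrow> 'k::field"
  assumes B: "buchsbaum G (MM :: (nat \<Rightarrow> 'k::field fps set) set)" and \<phi>: "\<phi> \<in> PhiT"
  shows "conv \<psi> \<phi> = (\<lambda>s. \<psi> 0 * \<phi> s)"
proof
  fix s
  have "conv \<psi> \<phi> s = (\<Sum>v\<in>{0}. if v \<in> S \<and> s - v \<in> S \<and> ord v + ord (s - v) = ord s
     then \<psi> v * \<phi> (s - v) else 0)"
    unfolding conv_def
  proof (rule sum.mono_neutral_right)
    show "\<forall>v\<in>{0..s} - {0}. (if v \<in> S \<and> s - v \<in> S \<and> ord v + ord (s - v) = ord s
      then \<psi> v * \<phi> (s - v) else 0) = 0"
    proof
      fix v assume v: "v \<in> {0..s} - {0}"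
      have "\<phi> (s - v) = 0" if "v \<in> S" "ord v + ord (s - v) = ord s"
        using buchsbaum_T[OF B, of "s - v" v] that v \<phi> by (auto simp: PhiT_def)
      then show "(if v \<in> S \<and> s - v \<in> S \<and> ord v + ord (s - v) = ord s then \<psi> v * \<phi> (s - v) else 0) = 0"
        by auto
    qed
  qed auto
  also have "\<dots> = \<psi> 0 * \<phi> s" using PhiT_Phi[OF \<phi>] by (auto simp: Phi_def)
  finally show "conv \<psi> \<phi> s = \<psi> 0 * \<phi> s" .
qed

section \<open>The length\<close>

lemma PhiT_add: "\<phi> \<in> PhiT \<Longrightarrow> \<psi> \<in> PhiT \<Longrightarrow> (\<lambda>s. \<phi> s + \<psi> s) \<in> PhiT"
  by (force simp: PhiT_def)

abbreviation HM :: "(nat \<Rightarrow> 'k::field fps set, nat \<Rightarrow> 'k fps set) module" where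
  "HM \<equiv> ideal_module G (H0 G MM)"

lemma HM_simps [simp]:
  "carrier HM = emb ` PhiT" "add HM = add G" "zero HM = emb (\<lambda>_. 0)" "smult HM = mult G"
  by (simp_all add: ideal_module_def H0_eq G_simps(1))

lemma abelian_group_HM: "abelian_group (HM :: (nat \<Rightarrow> 'k::field fps set, nat \<Rightarrow> 'k fps set) module)"
proof (rule abelian_groupI)
  fix x :: "nat \<Rightarrow> 'k fps set" assume "x \<in> carrier HM"
  then obtain \<phi> where \<phi>: "\<phi> \<in> PhiT" "x = emb \<phi>" by auto
  then show "\<exists>y\<in>carrier HM. y \<oplus>\<^bsub>HM\<^esub> x = \<zero>\<^bsub>HM\<^esub>"
    by (intro bexI[of _ "emb (\<lambda>s. - \<phi> s)"]) (auto simp: emb_add PhiT_def)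
qed (auto simp: emb_add ac_simps intro!: imageI PhiT_add, auto simp: PhiT_def)

text \<open>The coordinate subspace spanned by the classes with exponent in \<open>A\<close>; for
  \<open>A \<subseteq> T\<close> these supply the long chain.\<close>

definition sub :: "nat set \<Rightarrow> (nat \<Rightarrow> 'k::field fps set) set" where
  "sub A = emb ` {\<phi>. \<forall>s. \<phi> s \<noteq> 0 \<longrightarrow> s \<in> A}"

lemma submodule_sub:
  assumes B: "buchsbaum G (MM :: (nat \<Rightarrow> 'k::field fps set) set)" and A: "A \<subseteq> T"
  shows "submodule (sub A :: (nat \<Rightarrow> 'k fps set) set) G HM"
proof -
  interpret abelian_group "HM :: (nat \<Rightarrow> 'k fps set, nat \<Rightarrow> 'k fps set) module" by (rule abelian_group_HM)
  have sub: "{\<phi> :: nat \<Rightarrow> 'k. \<forall>s. \<phi> s \<noteq> 0 \<longrightarrow> s \<in> A} \<subseteq> PhiT" using A by (auto simp: PhiT_def)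
  show ?thesis
  proof (intro submodule.intro subgroup.intro submodule_axioms.intro)
    show "(sub A :: (nat \<Rightarrow> 'k fps set) set) \<subseteq> carrier (add_monoid HM)" using image_mono[OF sub, of emb] by (simp add: sub_def)
  next
    fix x y :: "nat \<Rightarrow> 'k fps set" assume "x \<in> sub A" "y \<in> sub A"
    then obtain \<phi> \<psi> where "x = emb \<phi>" "y = emb \<psi>" "\<forall>s. \<phi> s \<noteq> 0 \<longrightarrow> s \<in> A" "\<forall>s. \<psi> s \<noteq> 0 \<longrightarrow> s \<in> A"
      by (auto simp: sub_def)
    then show "x \<otimes>\<^bsub>add_monoid HM\<^esub> y \<in> sub A"
      by (force simp: emb_add sub_def intro!: imageI)
  next
    show "\<one>\<^bsub>add_monoid HM\<^esub> \<in> (sub A :: (nat \<Rightarrow> 'k fps set) set)" by (simp add: sub_def)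
  next
    fix x :: "nat \<Rightarrow> 'k fps set" assume "x \<in> sub A"
    then obtain \<phi> where \<phi>: "x = emb \<phi>" "\<forall>s. \<phi> s \<noteq> 0 \<longrightarrow> s \<in> A" by (auto simp: sub_def)
    have "\<ominus>\<^bsub>HM\<^esub> x = emb (\<lambda>s. - \<phi> s)"
      by (rule minus_equality) (use \<phi> A in \<open>auto simp: emb_add PhiT_def intro!: imageI\<close>)
    then show "inv\<^bsub>add_monoid HM\<^esub> x \<in> sub A" using \<phi>(2) by (auto simp: sub_def a_inv_def intro!: imageI)
  next
    fix y x :: "nat \<Rightarrow> 'k fps set" assume "y \<in> carrier G" "x \<in> sub A"
    then obtain \<phi> \<psi> where *: "x = emb \<phi>" "\<forall>s. \<phi> s \<noteq> 0 \<longrightarrow> s \<in> A" "y = emb \<psi>"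
      by (auto simp: sub_def carrier_G)
    then have "\<phi> \<in> PhiT" using A by (auto simp: PhiT_def)
    then have "y \<odot>\<^bsub>HM\<^esub> x = emb (\<lambda>s. \<psi> 0 * \<phi> s)"
      using * by (simp add: emb_mult conv_PhiT[OF B])
    then show "y \<odot>\<^bsub>HM\<^esub> x \<in> sub A" using * by (auto simp: sub_def intro!: imageI)
  qed
qed

text \<open>As \<open>MM\<close> kills \<open>H0\<close>, submodules of \<open>H0\<close> are the same as linear subspaces.\<close>

lemma submodule_chain_le:
  fixes N :: "nat \<Rightarrow> (nat \<Rightarrow> 'k::field fps set) set"
  assumes B: "buchsbaum G (MM :: (nat \<Rightarrow> 'k::field fps set) set)"
    and N: "\<And>i. i \<le> k \<Longrightarrow> submodule (N i) G HM" and chain: "\<And>i. i < k \<Longrightarrow> N i \<subset> N (Suc i)"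
  shows "k \<le> card T"
proof -
  \<comment> \<open>Coordinate vectors are treated as power series in order to use linear algebra
    over the coefficient field.\<close>
  interpret vector_space "\<lambda>c f. fps_const c * f :: 'k fps"
    by unfold_locales (simp_all add: algebra_simps fps_const_mult[symmetric] fps_const_add[symmetric]
        del: fps_const_mult fps_const_add)
  \<comment> \<open>The vectors representing \<open>N i\<close>. Membership in \<open>PhiT\<close>
    fixes their values outside \<open>S\<close>, which \<open>emb\<close> does not see.\<close>
  define V where "V i = {f. fps_nth f \<in> PhiT \<and> emb (fps_nth f) \<in> N i}" for i
  have V: "subspace (V i)" if i: "i \<le> k" for i
  proof -
    interpret N: submodule "N i" G HM by (rule N[OF i])
    show ?thesis
    proof (rule subspaceI)
      have "fps_nth 0 = (\<lambda>_. 0 :: 'k)" by (simp add: fun_eq_iff)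
      then show "0 \<in> V i" using N.one_closed by (simp add: V_def PhiT_def)
    next
      fix x y assume xy: "x \<in> V i" "y \<in> V i"
      have "emb (fps_nth (x + y)) = emb (fps_nth x) \<oplus>\<^bsub>G\<^esub> emb (fps_nth y)"
        unfolding emb_add emb_eq_iff by simp
      moreover have "fps_nth (x + y) \<in> PhiT" using xy by (force simp: V_def PhiT_def)
      ultimately show "x + y \<in> V i" using N.m_closed[of "emb (fps_nth x)" "emb (fps_nth y)"] xy
        by (simp add: V_def)
    next
      fix c x assume x: "x \<in> V i"
      have nth: "fps_nth (fps_const c * x) = (\<lambda>s. c * fps_nth x s)" by (simp add: fun_eq_iff)
      \<comment> \<open>\<open>delta c 0\<close> is the scalar \<open>c\<close> in degree 0 of
        \<open>G\<close>, so closure under \<open>G\<close> includes closure under scalars.\<close>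
      have "emb (delta c 0) \<otimes>\<^bsub>G\<^esub> emb (fps_nth x) = emb (fps_nth (fps_const c * x))"
        unfolding emb_mult nth using conv_PhiT[OF B, of "fps_nth x" "delta c 0"] x
        by (simp add: V_def delta_def)
      moreover have "emb (delta c 0) \<in> carrier G" by (simp add: carrier_G delta_Phi)
      ultimately have "emb (fps_nth (fps_const c * x)) \<in> N i"
        using N.smult_closed[of "emb (delta c 0)" "emb (fps_nth x)"] x by (simp add: V_def)
      then show "fps_const c * x \<in> V i" using x by (auto simp: V_def PhiT_def)
    qed
  qed
  \<comment> \<open>Each strict inclusion of the chain contributes a vector outside the span of the
    earlier ones.\<close>
  have "\<exists>C. independent C \<and> C \<subseteq> V i \<and> finite C \<and> card C = i" if "i \<le> k" for i
    using that
  proof (induction i)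
    case 0
    then show ?case by (intro exI[of _ "{}"]) (simp add: dependent_def)
  next
    case (Suc i)
    then obtain C where C: "independent C" "C \<subseteq> V i" "finite C" "card C = i" by auto
    obtain x where x: "x \<in> N (Suc i)" "x \<notin> N i" using chain[of i] Suc.prems by auto
    have "N (Suc i) \<subseteq> emb ` PhiT" using subgroup.subset[OF submodule.axioms(1)[OF N[OF Suc.prems]]] by simp
    then obtain \<phi> where \<phi>: "\<phi> \<in> PhiT" "x = emb \<phi>" using x(1) by blast
    have nth: "fps_nth (Abs_fps \<phi>) = \<phi>" by (simp add: fun_eq_iff)
    have in_V: "Abs_fps \<phi> \<in> V (Suc i)" "Abs_fps \<phi> \<notin> V i" using x \<phi> by (auto simp: V_def nth)
    have "span C \<subseteq> V i" using C(2) V[of i] Suc.prems by (intro span_minimal) auto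
    then have notin: "Abs_fps \<phi> \<notin> span C" using in_V by blast
    then have "Abs_fps \<phi> \<notin> C" using span_base by blast
    moreover have "V i \<subseteq> V (Suc i)" using chain[of i] Suc.prems by (auto simp: V_def)
    ultimately show ?case using C notin in_V
      by (intro exI[of _ "insert (Abs_fps \<phi>) C"]) (auto simp: independent_insert)
  qed
  then obtain C where C: "independent C" "C \<subseteq> V k" "card C = k" by blast
  \<comment> \<open>All the vectors live in a space spanned by at most \<open>card T\<close>
    monomials, which bounds the length of the chain.\<close>
  have "V k \<subseteq> span ((\<lambda>s. fps_X ^ s) ` T)"
  proof
    fix f assume f: "f \<in> V k"
    have "f = (\<Sum>s\<in>T. fps_const (fps_nth f s) * fps_X ^ s)"
    proof (rule fps_ext)
      fix u
      have "(\<Sum>s\<in>T. fps_nth (fps_const (fps_nth f s) * fps_X ^ s) u) = (\<Sum>s\<in>T. if u = s then fps_nth f s else 0)"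
        by (rule sum.cong[OF refl]) (simp add: fps_X_power_nth)
      also have "\<dots> = fps_nth f u" using finite_T f by (auto simp: V_def PhiT_def)
      finally show "fps_nth f u = fps_nth (\<Sum>s\<in>T. fps_const (fps_nth f s) * fps_X ^ s) u"
        by (simp add: fps_sum_nth)
    qed
    also have "\<dots> \<in> span ((\<lambda>s. fps_X ^ s) ` T)"
      by (intro span_sum span_scale span_base) simp
    finally show "f \<in> span ((\<lambda>s. fps_X ^ s) ` T)" .
  qed
  then have "card C \<le> card ((\<lambda>s. fps_X ^ s :: 'k fps) ` T)"
    using independent_span_bound[of "(\<lambda>s. fps_X ^ s) ` T" C] C finite_T by auto
  also have "\<dots> \<le> card T" using finite_T by (rule card_image_le)
  finally show ?thesis using C(3) by simp
qed

lemma module_length_HM: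
  assumes B: "buchsbaum G (MM :: (nat \<Rightarrow> 'k::field fps set) set)"
  shows "module_length G (HM :: (nat \<Rightarrow> 'k fps set, nat \<Rightarrow> 'k fps set) module) = enat (card T)"
proof (rule antisym)
  show "module_length G (HM :: (nat \<Rightarrow> 'k fps set, nat \<Rightarrow> 'k fps set) module) \<le> enat (card T)"
    unfolding module_length_def
    by (rule Sup_least) (use submodule_chain_le[OF B] in \<open>fastforce\<close>)
  \<comment> \<open>Enumerating \<open>T\<close> and adjoining one basis class at a time gives a
    strict chain with \<open>card T\<close> steps.\<close>
  obtain h where h: "bij_betw h {0..<card T} T" using ex_bij_betw_nat_finite[OF finite_T] by blast
  define N :: "nat \<Rightarrow> (nat \<Rightarrow> 'k fps set) set" where "N i = sub (h ` {0..<i})" for i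
  have hT: "h ` {0..<i} \<subseteq> T" if "i \<le> card T" for i
    using h that by (auto simp: bij_betw_def)
  have "submodule (N i) G HM" if "i \<le> card T" for i
    unfolding N_def using submodule_sub[OF B hT[OF that]] .
  moreover have "N i \<subset> N (Suc i)" if i: "i < card T" for i
  proof
    show "N i \<subseteq> N (Suc i)" unfolding N_def sub_def by (intro image_mono) force
    have hi: "h i \<notin> h ` {0..<i}"
      using h i inj_on_image_mem_iff[of h "{0..<card T}" i "{0..<i}"] by (simp add: bij_betw_def)
    have "emb (delta 1 (h i)) \<notin> N i"
    proof
      assume "emb (delta 1 (h i)) \<in> N i"
      then obtain \<phi> :: "nat \<Rightarrow> 'k" where \<phi>: "emb (delta 1 (h i)) = emb \<phi>" "\<forall>s. \<phi> s \<noteq> 0 \<longrightarrow> s \<in> h ` {0..<i}"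
        by (auto simp: N_def sub_def)
      have "h i \<in> h ` {0..<Suc i}" by simp
      then have "h i \<in> S" using hT[of "Suc i"] i T_subset_S by (meson Suc_leI subsetD)
      then have "\<phi> (h i) = 1" using \<phi>(1) by (auto simp: emb_eq_iff delta_def)
      then show False using \<phi>(2) hi by force
    qed
    moreover have "emb (delta 1 (h i)) \<in> N (Suc i)"
      unfolding N_def sub_def by (rule imageI) (simp add: delta_def)
    ultimately show "N i \<noteq> N (Suc i)" by blast
  qed
  ultimately show "enat (card T) \<le> module_length G (HM :: (nat \<Rightarrow> 'k fps set, nat \<Rightarrow> 'k fps set) module)"
    unfolding module_length_def by (intro Sup_upper) blast
qed

text \<open>Ensures that r may serve as the \<open>k \<ge> 1\<close> in \<open>T\<close>. If r were
  0, m would be the principal ideal of t^(g_1), and \<open>w i - g 1\<close> would be a smaller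
  element of \<open>S\<close> in the class of \<open>i\<close>.\<close>

lemma reduction_number_pos:
  assumes i: "i < g 1" and less: "ord (w i) < a i"
  shows "1 \<le> reduction_number R (m :: 'k::field fps set) (fps_X ^ g 1)"
proof (rule ccontr)
  let ?P = "\<lambda>r. (F (r + 1) :: 'k fps set) = fps_X ^ g 1 <#\<^bsub>R\<^esub> F r"
  obtain H where H: "\<forall>h\<ge>H. \<forall>s\<in>hM (Suc h). \<exists>t\<in>hM h. s = g 1 + t" using ex_reduction ..
  \<comment> \<open>The least r has the defining property only once some exponent is known to have
    it.\<close>
  have "?P H"
  proof (intro equalityI subsetI)
    fix f :: "'k fps" assume f: "f \<in> F (H + 1)"
    have *: "g 1 \<le> s \<and> s - g 1 \<in> hM H" if s: "fps_nth f s \<noteq> 0" for s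
    proof -
      have "s \<in> hM (Suc H)" using f s by (simp add: filt_def Suc_eq_plus1[symmetric] del: Suc_eq_plus1)
      then obtain t where "t \<in> hM H" "s = g 1 + t" using H by blast
      then show ?thesis by simp
    qed
    have "fps_shift (g 1) f \<in> F H" using * by (force simp: filt_def)
    moreover have "f = fps_X ^ g 1 * fps_shift (g 1) f"
    proof (rule fps_ext)
      fix s show "fps_nth f s = fps_nth (fps_X ^ g 1 * fps_shift (g 1) f) s"
        using *[of s] by (cases "fps_nth f s = 0") (auto simp: fps_X_power_mult_nth)
    qed
    ultimately show "f \<in> fps_X ^ g 1 <#\<^bsub>R\<^esub> F H" by (auto simp: l_coset_def)
  next
    fix f :: "'k fps" assume "f \<in> fps_X ^ g 1 <#\<^bsub>R\<^esub> F H"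
    then obtain f' where "f' \<in> F H" "f = fps_X ^ g 1 * f'" by (auto simp: l_coset_def)
    then show "f \<in> F (H + 1)" using F_mult[of f' H "fps_X ^ g 1" 1] X_power_F[OF g_hM1[OF one_mem]]
      by (simp add: mult.commute)
  qed
  then have P: "?P (reduction_number R (m :: 'k fps set) (fps_X ^ g 1))"
    unfolding reduction_number_def ideal_pow_max_ideal by (rule LeastI)
  assume "\<not> 1 \<le> reduction_number R (m :: 'k fps set) (fps_X ^ g 1)"
  then have "reduction_number R (m :: 'k fps set) (fps_X ^ g 1) = 0" by simp
  from P[unfolded this] have P0: "(F 1 :: 'k fps set) = fps_X ^ g 1 <#\<^bsub>R\<^esub> F 0" by simp
  have "w i \<noteq> 0"
  proof
    assume "w i = 0"
    then have "a i = 0" using w_eq[of i] g1_pos by simp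
    then show False using less by simp
  qed
  then have "w i \<in> hM 1" using w_props(1) ord_pos_iff[of "w i"] by (simp add: mem_hM_iff)
  then have "(fps_X ^ w i :: 'k fps) \<in> F 1" by (rule X_power_F)
  then obtain f :: "'k fps" where f: "f \<in> F 0" "fps_X ^ w i = fps_X ^ g 1 * f" unfolding P0 by (auto simp: l_coset_def)
  have "fps_nth (fps_X ^ g 1 * f) (w i) = 1" unfolding f(2)[symmetric] by simp
  then have "g 1 \<le> w i" "fps_nth f (w i - g 1) \<noteq> 0" by (auto simp: fps_X_power_mult_nth split: if_splits)
  then have *: "w i - g 1 \<in> S" "g 1 \<le> w i" using f(1) by (auto simp: filt_def)
  have "[w i - g 1 = i] (mod g 1)" using w_props(2)[of i] *(2) by (simp add: cong_def le_mod_geq)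
  then show False using w_le[OF *(1)] *(2) g1_pos by fastforce
qed

text \<open>For r at least 1, the annihilator of the r-th power of \<open>MM\<close> sees the same
  exponents as \<open>T\<close>: r itself is a witness in one direction, and in the other
  \<open>buchsbaum_T\<close> covers every nonzero \<open>u\<close>.\<close>

lemma l_num_eq:
  assumes B: "buchsbaum G (MM :: (nat \<Rightarrow> 'k::field fps set) set)"
    and i: "i < g 1" and less: "ord (w i) < a i"
  shows "l_num TYPE('k) n g i = Max {l. w i + l * g 1 \<in> T}"
proof -
  define r where "r = reduction_number R (m :: 'k fps set) (fps_X ^ g 1)"
  have r: "1 \<le> r" unfolding r_def by (rule reduction_number_pos[OF i less])
  have "(monomial_class S (m :: 'k fps set) s \<in> annihilator G (ideal_pow G MM r)) \<longleftrightarrow> s \<in> T"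
    if s: "s \<in> S" for s
  proof -
    have "(monomial_class S (m :: 'k fps set) s \<in> annihilator G (ideal_pow G MM r))
      \<longleftrightarrow> (\<forall>u. u \<in> S \<longrightarrow> r \<le> ord u \<longrightarrow> ord (s + u) \<noteq> ord s + ord u)"
      unfolding monomial_class_eq[OF s] annihilator_iff[OF delta_Phi[OF s]] by (auto simp: delta_def)
    also have "\<dots> \<longleftrightarrow> s \<in> T"
    proof
      assume "\<forall>u. u \<in> S \<longrightarrow> r \<le> ord u \<longrightarrow> ord (s + u) \<noteq> ord s + ord u"
      then show "s \<in> T" unfolding T_def using s r by blast
    next
      assume sT: "s \<in> T"
      show "\<forall>u. u \<in> S \<longrightarrow> r \<le> ord u \<longrightarrow> ord (s + u) \<noteq> ord s + ord u"
      proof (intro allI impI)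
        fix u assume u: "u \<in> S" "r \<le> ord u"
        then have "u \<noteq> 0" using r by (cases "u = 0") auto
        then show "ord (s + u) \<noteq> ord s + ord u" using buchsbaum_T[OF B sT u(1)] by (simp add: add.commute)
      qed
    qed
    finally show ?thesis .
  qed
  then have "{l. monomial_class S (m :: 'k fps set) (w i + l * g 1) \<in> annihilator G (ideal_pow G MM r)}
    = {l. w i + l * g 1 \<in> T}" using w_props(1)[of i] add_S g1_S by blast
  then show ?thesis unfolding l_num_def Let_def S_eq[symmetric] r_def by simp
qed

lemma length_formula:
  assumes B: "buchsbaum G (MM :: (nat \<Rightarrow> 'k::field fps set) set)"
  shows "module_length G (ideal_module G (H0 G (MM :: (nat \<Rightarrow> 'k fps set) set))) =
    enat (\<Sum>i \<in> {i \<in> {0..g 1 - 1}. a_num n g i > int (b_num n g i)}. (l_num TYPE('k) n g i + 1))"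
proof -
  have "l_num TYPE('k) n g i = Max {l. w i + l * g 1 \<in> T}"
    if "i \<in> {i \<in> {0..g 1 - 1}. a_num n g i > int (b_num n g i)}" for i
    using that g1_pos by (intro l_num_eq[OF B]) (auto simp: a_num_eq b_num_eq)
  then show ?thesis unfolding module_length_HM[OF B] card_T by simp
qed

end

theorem proposition3p15:
  fixes n :: nat and g :: "nat \<Rightarrow> nat" and S :: "nat set"
    and R :: "('k::field fps) ring" and m :: "'k fps set"
    and G :: "(nat \<Rightarrow> 'k fps set) ring" and MM :: "(nat \<Rightarrow> 'k fps set) set"
  assumes infinite_K: "infinite (UNIV :: 'k set)"
    and n: "n \<ge> 1"
    and increasing: "strict_mono_on {1..n} g"
    and minimal: "\<And>j. j \<in> {1..n} \<Longrightarrow> g j \<notin> semigroup_gen (g ` ({1..n} - {j}))"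
    and gcd: "Gcd (g ` {1..n}) = 1"
    and S: "S = semigroup_gen (g ` {1..n})"
    and R: "R = semigroup_ring S"
    and m: "m = max_ideal n g"
    and G: "G = assoc_graded R m"
    and MM: "MM = graded_max R m"
    and buchsbaum: "buchsbaum G MM"
  shows "module_length G (ideal_module G (H0 G MM)) =
    enat (\<Sum>i \<in> {i \<in> {0..g 1 - 1}. a_num n g i > int (b_num n g i)}. (l_num TYPE('k) n g i + 1))"
proof -
  have "num_semigroup n g S"
  proof
    \<comment> \<open>Every generated semigroup contains 0, so minimality of the generator
      \<open>g 1\<close> makes it positive.\<close>
    have "g 1 \<notin> semigroup_gen (g ` ({1..n} - {1}))" using minimal[of 1] n by simp
    then show "0 < g 1" using semigroup_gen.zero by (cases "g 1 = 0") auto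
    show "g 1 \<le> g j" if "j \<in> {1..n}" for j
      using strict_mono_onD[OF increasing, of 1 j] that n by (cases "j = 1") auto
  qed (fact n gcd S)+
  then show ?thesis using num_semigroup.length_formula buchsbaum unfolding G MM R m by blast
qed

end
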